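(* For $i\ge1$ let $S_{i,i}$ be a $\mathbb{Z}_2$-graded irreducible real $C\ell_{i,i}$-module with Clifford map $c_{i,i}$ (vectors acting by odd operators), and set $S_{0,0}=\mathbb{R}$ (purely even, $c_{0,0}=0$). For $a,b\ge1$ let $S_{a,0}$ and $S_{0,b}$ be irreducible real modules over $C\ell_{a,0}$ and $C\ell_{0,b}$ with Clifford maps $c_{a,0}$, $c_{0,b}$. Let $r,s\ge0$ with $r+s\ge1$, and let $i=\min(r,s)$, so that $(r,s)-(i,i)$ equals $(a,0)$ or $(0,b)$ with $a,b\geq 0$. If $a\ge1$, the map $$c_{r,s}:\mathbb{R}^{2i}\oplus\mathbb{R}^a\to\mathrm{End}_{\mathbb{R}}(S_{i,i}\otimes_{\mathbb{R}}S_{a,0}),\qquad(u,v)\mapsto c_{i,i}(u)\otimes I_{S_{a,0}}+I_{S_{i,i}}\hat\otimes c_{a,0}(v)$$ satisfies the Clifford condition and makes $S_{i,i}\otimes_{\mathbb{R}}S_{a,0}$ an irreducible $C\ell_{r,s}$-module. If $b\ge1$, the map $$c_{r,s}:\mathbb{R}^{2i}\oplus\mathbb{R}^b\to\mathrm{End}_{\mathbb{R}}(S_{i,i}\otimes_{\mathbb{R}}S_{0,b}),\qquad(u,v)\mapsto c_{i,i}(u)\otimes I_{S_{0,b}}+I_{S_{i,i}}\hat\otimes c_{0,b}(v)$$ satisfies the Clifford condition and makes $S_{i,i}\otimes_{\mathbb{R}}S_{0,b}$ an irreducible $C\ell_{r,s}$-module. Moreover, if $a\equiv1\pmod4$ (respectively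 $b\equiv3\pmod 4$), replacing $S_{a,0}$ (respectively $S_{0,b}$) by the other, non-isomorphic irreducible module of $C\ell_{a,0}$ (respectively $C\ell_{0,b}$) gives the other irreducible $C\ell_{r,s}$-module; thus all irreducible real $C\ell_{r,s}$-modules are obtained up to isomorphism.
   Context: $C\ell_{r,s}$ is the unital real Clifford algebra of $\mathbb{R}^{r+s}$ with a nondegenerate symmetric bilinear form $g_{r,s}$ having $r$ diagonal entries $-1$ and $s$ diagonal entries $+1$ in a $g_{r,s}$-orthonormal basis, with relations $v\cdot w+w\cdot v=-2g_{r,s}(v,w)$. The Clifford condition for a linear map $c$ is $c(v)c(w)+c(w)c(v)=-2g_{r,s}(v,w)$. The space $\mathbb{R}^{2i}$ carries $g_{i,i}$, and $\mathbb{R}^{r+s}$ is the orthogonal direct sum of $\mathbb{R}^{2i}$ and $(\mathbb{R}^a,g_{a,0})$ or $(\mathbb{R}^b,g_{0,b})$. For a $\mathbb{Z}_2$-graded space $M=M^+\oplus M^-$ and an operator $T$ on $N$ representing a vector, $I_M\hat\otimes T$ denotes the operator equal to $I\otimes T$ on $M^+\otimes N$ and $-I\otimes T$ on $M^-\otimes N$. In the paper's construction $S_{a,0}$ for $a\equiv1\pmod4$ contains a tensor factor $S_{1,0}$ and $S_{0,b}$ for $b\equiv3\pmod4$ contains a factor $S_{0,3}$; the other irreducible module is obtained by changing the sign of the Clifford map of that factor. *)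

theory Defs
  imports "HOL-Analysis.Analysis" "HOL-Analysis.Finite_Function_Topology" "HOL-Algebra.QuotRing"
begin

section \<open>Real Clifford algebras\<close>

datatype 'v free_monoid = Word "'v list"

instantiation free_monoid :: (type) monoid_add
begin

definition "0 = Word []"

fun plus_free_monoid :: "'a free_monoid \<Rightarrow> 'a free_monoid \<Rightarrow> 'a free_monoid" where
  "Word u + Word w = Word (u @ w)"

instance
proof
  fix x y z :: "'a free_monoid"
  show "x + y + z = x + (y + z)" by (cases x; cases y; cases z) simp
  show "0 + x = x" "x + 0 = x" by (cases x; simp add: zero_free_monoid_def)+
qed

end

text \<open>
  Finitely supported real functions on words, with the convolution product of
  \<open>HOL-Library.Poly_Mapping\<close>, form the free unital real algebra on a set of letters.
\<close>

definition free_algebra :: "'v set \<Rightarrow> ('v free_monoid \<Rightarrow>\<^sub>0 real) ring" where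
  "free_algebra V =
    \<lparr>carrier = {p. Poly_Mapping.keys p \<subseteq> Word ` lists V},
     mult = (*), one = 1, zero = 0, add = (+)\<rparr>"

definition letter :: "'v \<Rightarrow> 'v free_monoid \<Rightarrow>\<^sub>0 real" where
  "letter v = Poly_Mapping.single (Word [v]) 1"

text \<open>
  The letters are all vectors of \<open>V\<close>, so linearity of the inclusion of \<open>V\<close> is imposed by
  relations; together with the free algebra these present the tensor algebra of \<open>V\<close>.
\<close>

definition clifford_relations ::
    "'v::real_vector set \<Rightarrow> ('v \<Rightarrow> 'v \<Rightarrow> real) \<Rightarrow> ('v free_monoid \<Rightarrow>\<^sub>0 real) set" where
  "clifford_relations V g =
     {letter (v + w) - (letter v + letter w) | v w. v \<in> V \<and> w \<in> V} \<union>
     {letter (t *\<^sub>R v) - t *\<^sub>R letter v | t v. v \<in> V} \<union>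
     {letter v * letter w + letter w * letter v + (2 * g v w) *\<^sub>R 1 | v w. v \<in> V \<and> w \<in> V}"

definition clifford_ideal ::
    "'v::real_vector set \<Rightarrow> ('v \<Rightarrow> 'v \<Rightarrow> real) \<Rightarrow> ('v free_monoid \<Rightarrow>\<^sub>0 real) set" where
  "clifford_ideal V g = genideal (free_algebra V) (clifford_relations V g)"

type_synonym 'v clifford = "('v free_monoid \<Rightarrow>\<^sub>0 real) set"

definition clifford_algebra ::
    "'v::real_vector set \<Rightarrow> ('v \<Rightarrow> 'v \<Rightarrow> real) \<Rightarrow> 'v clifford ring" where
  "clifford_algebra V g = free_algebra V Quot clifford_ideal V g"

text \<open>The structure maps of the real numbers and of \<open>V\<close> into the Clifford algebra.\<close>

definition clifford_scalar ::
    "'v::real_vector set \<Rightarrow> ('v \<Rightarrow> 'v \<Rightarrow> real) \<Rightarrow> real \<Rightarrow> 'v clifford" where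
  "clifford_scalar V g t = clifford_ideal V g +>\<^bsub>free_algebra V\<^esub> (t *\<^sub>R 1)"

definition clifford_vector ::
    "'v::real_vector set \<Rightarrow> ('v \<Rightarrow> 'v \<Rightarrow> real) \<Rightarrow> 'v \<Rightarrow> 'v clifford" where
  "clifford_vector V g v = clifford_ideal V g +>\<^bsub>free_algebra V\<^esub> letter v"

lemma free_algebra_ring: "ring (free_algebra V)"
proof -
  have mult: "Poly_Mapping.keys (p * q) \<subseteq> Word ` lists V"
    if sub: "Poly_Mapping.keys p \<subseteq> Word ` lists V" "Poly_Mapping.keys q \<subseteq> Word ` lists V"
    for p q :: "'a free_monoid \<Rightarrow>\<^sub>0 real"
  proof
    fix x assume "x \<in> Poly_Mapping.keys (p * q)"
    then obtain a b where ab: "x = a + b" "a \<in> Poly_Mapping.keys p" "b \<in> Poly_Mapping.keys q"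
      using keys_mult[of p q] by blast
    then obtain u w where uw: "a = Word u" "b = Word w" "u \<in> lists V" "w \<in> lists V"
      using sub by (meson imageE subsetD)
    then have "x = Word (u @ w)" "u @ w \<in> lists V" using ab by auto
    then show "x \<in> Word ` lists V" by blast
  qed
  have add: "Poly_Mapping.keys (p + q) \<subseteq> Word ` lists V"
    if "Poly_Mapping.keys p \<subseteq> Word ` lists V" "Poly_Mapping.keys q \<subseteq> Word ` lists V"
    for p q :: "'a free_monoid \<Rightarrow>\<^sub>0 real"
    using that Poly_Mapping.keys_add[of p q] by blast
  have one: "Poly_Mapping.keys (1 :: 'a free_monoid \<Rightarrow>\<^sub>0 real) \<subseteq> Word ` lists V"
    by (auto simp: zero_free_monoid_def)
  show ?thesis
  proof (rule ringI)
    show "abelian_group (free_algebra V)"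
    proof (rule abelian_groupI)
      fix p assume p: "p \<in> carrier (free_algebra V)"
      then show "\<exists>q\<in>carrier (free_algebra V). q \<oplus>\<^bsub>free_algebra V\<^esub> p = \<zero>\<^bsub>free_algebra V\<^esub>"
        by (intro bexI[of _ "- p"]) (auto simp: free_algebra_def)
    qed (use add in \<open>auto simp: free_algebra_def algebra_simps\<close>)
    show "Group.monoid (free_algebra V)"
      by (rule monoidI) (use mult one in \<open>auto simp: free_algebra_def algebra_simps\<close>)
  qed (auto simp: free_algebra_def algebra_simps)
qed

lemma clifford_relations_subset:
  assumes "subspace V"
  shows "clifford_relations V g \<subseteq> carrier (free_algebra V)"
proof -
  interpret ring "free_algebra V" by (rule free_algebra_ring)
  have add: "p + q \<in> carrier (free_algebra V)"
    if "p \<in> carrier (free_algebra V)" "q \<in> carrier (free_algebra V)" for p q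
    using a_closed[OF that] by (simp add: free_algebra_def)
  have mult: "p * q \<in> carrier (free_algebra V)"
    if "p \<in> carrier (free_algebra V)" "q \<in> carrier (free_algebra V)" for p q
    using m_closed[OF that] by (simp add: free_algebra_def)
  have one: "1 \<in> carrier (free_algebra V)"
    using one_closed by (simp add: free_algebra_def)
  have scale: "t *\<^sub>R p \<in> carrier (free_algebra V)" if "p \<in> carrier (free_algebra V)" for t p
  proof -
    have "Poly_Mapping.keys (t *\<^sub>R p) \<subseteq> Poly_Mapping.keys p"
      by (auto simp: in_keys_iff scaleR_poly_mapping_def Abs_poly_mapping_inverse
          finite_subset[OF _ finite_lookup[of p]])
    then show ?thesis using that by (auto simp: free_algebra_def)
  qed
  have diff: "p - q \<in> carrier (free_algebra V)"
    if "p \<in> carrier (free_algebra V)" "q \<in> carrier (free_algebra V)" for p q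
    using add[OF that(1) scale[OF that(2), of "-1"]] by simp
  have letter: "letter v \<in> carrier (free_algebra V)" if "v \<in> V" for v
    using that by (auto simp: free_algebra_def letter_def)
  show ?thesis
    using assms unfolding clifford_relations_def
    by (auto intro!: add diff mult scale one letter simp: subspace_add subspace_scale)
qed

lemma clifford_algebra_ring:
  assumes "subspace V"
  shows "ring (clifford_algebra V g)"
  unfolding clifford_algebra_def clifford_ideal_def
  by (intro ideal.quotient_is_ring ring.genideal_ideal free_algebra_ring
      clifford_relations_subset assms)


section \<open>Modules\<close>

definition End_ring :: "('a::real_vector \<Rightarrow> 'a) ring" where
  "End_ring = \<lparr>carrier = {f. linear f}, mult = (\<circ>), one = id,
     zero = (\<lambda>x. 0), add = (\<lambda>f h x. f x + h x)\<rparr>"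

text \<open>
  A real module is a unital homomorphism of real algebras into the endomorphisms of a real
  vector space; only the values on the carrier of the Clifford algebra are relevant.
\<close>

definition clifford_module ::
    "'v::real_vector set \<Rightarrow> ('v \<Rightarrow> 'v \<Rightarrow> real) \<Rightarrow> ('v clifford \<Rightarrow> 'a \<Rightarrow> 'a::real_vector) \<Rightarrow> bool" where
  "clifford_module V g \<rho> \<longleftrightarrow>
     \<rho> \<in> ring_hom (clifford_algebra V g) End_ring \<and>
     (\<forall>t. \<rho> (clifford_scalar V g t) = (\<lambda>x. t *\<^sub>R x))"

definition irreducible_clifford_module ::
    "'v::real_vector set \<Rightarrow> ('v \<Rightarrow> 'v \<Rightarrow> real) \<Rightarrow> ('v clifford \<Rightarrow> 'a \<Rightarrow> 'a::real_vector) \<Rightarrow> bool" where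
  "irreducible_clifford_module V g \<rho> \<longleftrightarrow>
     clifford_module V g \<rho> \<and> (UNIV :: 'a set) \<noteq> {0} \<and>
     (\<forall>U. subspace U \<and> (\<forall>A\<in>carrier (clifford_algebra V g). \<rho> A ` U \<subseteq> U) \<longrightarrow>
        U = {0} \<or> U = UNIV)"

definition isomorphic_clifford_modules ::
    "'v::real_vector set \<Rightarrow> ('v \<Rightarrow> 'v \<Rightarrow> real) \<Rightarrow> ('v clifford \<Rightarrow> 'a \<Rightarrow> 'a::real_vector) \<Rightarrow>
      ('v clifford \<Rightarrow> 'b \<Rightarrow> 'b::real_vector) \<Rightarrow> bool" where
  "isomorphic_clifford_modules V g \<rho> \<sigma> \<longleftrightarrow>
     (\<exists>f. linear f \<and> bij f \<and>
        (\<forall>A\<in>carrier (clifford_algebra V g). \<forall>x. f (\<rho> A x) = \<sigma> A (f x)))"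

text \<open>A linear map \<open>V \<rightarrow> End(S)\<close> satisfying the Clifford condition.\<close>

definition clifford_condition ::
    "'v::real_vector set \<Rightarrow> ('v \<Rightarrow> 'v \<Rightarrow> real) \<Rightarrow> ('v \<Rightarrow> 'a \<Rightarrow> 'a::real_vector) \<Rightarrow> bool" where
  "clifford_condition V g c \<longleftrightarrow>
     (\<forall>v\<in>V. linear (c v)) \<and>
     (\<forall>v\<in>V. \<forall>w\<in>V. \<forall>x. c (v + w) x = c v x + c w x) \<and>
     (\<forall>t. \<forall>v\<in>V. \<forall>x. c (t *\<^sub>R v) x = t *\<^sub>R c v x) \<and>
     (\<forall>v\<in>V. \<forall>w\<in>V. \<forall>x. c v (c w x) + c w (c v x) = (- 2 * g v w) *\<^sub>R x)"

text \<open>The Clifford map of a module.\<close>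

definition module_map ::
    "'v::real_vector set \<Rightarrow> ('v \<Rightarrow> 'v \<Rightarrow> real) \<Rightarrow> ('v clifford \<Rightarrow> 'a \<Rightarrow> 'a) \<Rightarrow> 'v \<Rightarrow> 'a \<Rightarrow> 'a" where
  "module_map V g \<rho> v = \<rho> (clifford_vector V g v)"

definition has_clifford_map ::
    "'v::real_vector set \<Rightarrow> ('v \<Rightarrow> 'v \<Rightarrow> real) \<Rightarrow> ('v clifford \<Rightarrow> 'a \<Rightarrow> 'a::real_vector) \<Rightarrow>
      ('v \<Rightarrow> 'a \<Rightarrow> 'a) \<Rightarrow> bool" where
  "has_clifford_map V g \<rho> c \<longleftrightarrow>
     clifford_module V g \<rho> \<and> (\<forall>v\<in>V. module_map V g \<rho> v = c v)"

definition Z2_grading :: "'a::real_vector set \<Rightarrow> 'a set \<Rightarrow> bool" where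
  "Z2_grading Mp Mm \<longleftrightarrow>
     subspace Mp \<and> subspace Mm \<and> Mp \<inter> Mm = {0} \<and> (\<forall>x. \<exists>y\<in>Mp. \<exists>z\<in>Mm. x = y + z)"

definition graded_clifford_module ::
    "'v::real_vector set \<Rightarrow> ('v \<Rightarrow> 'v \<Rightarrow> real) \<Rightarrow> ('v clifford \<Rightarrow> 'a \<Rightarrow> 'a::real_vector) \<Rightarrow>
      'a set \<Rightarrow> 'a set \<Rightarrow> bool" where
  "graded_clifford_module V g \<rho> Mp Mm \<longleftrightarrow>
     clifford_module V g \<rho> \<and> Z2_grading Mp Mm \<and>
     (\<forall>v\<in>V. module_map V g \<rho> v ` Mp \<subseteq> Mm \<and> module_map V g \<rho> v ` Mm \<subseteq> Mp)"


section \<open>The quadratic spaces \<open>\<real>\<^bsup>r+s\<^esup>\<close>\<close>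

text \<open>\<open>\<real>\<^bsup>n\<^esup>\<close> consists of the finitely supported sequences with support below \<open>n\<close>.\<close>

definition Rn :: "nat \<Rightarrow> (nat \<Rightarrow>\<^sub>0 real) set" where
  "Rn n = {v. \<forall>k\<ge>n. Poly_Mapping.lookup v k = 0}"

text \<open>The first \<open>r\<close> basis vectors have square \<open>-1\<close> and the next \<open>s\<close> have square \<open>1\<close>.\<close>

definition gform :: "nat \<Rightarrow> nat \<Rightarrow> (nat \<Rightarrow>\<^sub>0 real) \<Rightarrow> (nat \<Rightarrow>\<^sub>0 real) \<Rightarrow> real" where
  "gform r s v w =
     (\<Sum>k<s. Poly_Mapping.lookup v (r + k) * Poly_Mapping.lookup w (r + k)) -
     (\<Sum>k<r. Poly_Mapping.lookup v k * Poly_Mapping.lookup w k)"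

definition vec_of :: "nat \<Rightarrow> (nat \<Rightarrow> real) \<Rightarrow> (nat \<Rightarrow>\<^sub>0 real)" where
  "vec_of n f = (\<Sum>k<n. Poly_Mapping.single k (f k))"

text \<open>
  The identification of \<open>\<real>\<^bsup>r+s\<^esup>\<close> with the orthogonal direct sum of
  \<open>(\<real>\<^bsup>2i\<^esup>, g\<^bsub>i,i\<^esub>)\<close> and \<open>(\<real>\<^bsup>r+s-2i\<^esup>, g\<^bsub>r-i,s-i\<^esub>)\<close>, where \<open>i\<close> is the minimum of
  \<open>r\<close> and \<open>s\<close>: the first \<open>i\<close> negative and the first \<open>i\<close> positive coordinates make up the
  first summand.
\<close>

definition split_vec ::
    "nat \<Rightarrow> nat \<Rightarrow> (nat \<Rightarrow>\<^sub>0 real) \<Rightarrow> (nat \<Rightarrow>\<^sub>0 real) \<times> (nat \<Rightarrow>\<^sub>0 real)" where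
  "split_vec r s v = (let i = min r s in
     (vec_of (2 * i) (\<lambda>k. if k < i then Poly_Mapping.lookup v k
                          else Poly_Mapping.lookup v (r + (k - i))),
      vec_of (r + s - 2 * i) (\<lambda>k. if k < r - i then Poly_Mapping.lookup v (i + k)
                          else Poly_Mapping.lookup v (r + i + (k - (r - i))))))"

lemma subspace_Rn: "subspace (Rn n)"
  by (auto simp: subspace_def Rn_def lookup_add scaleR_poly_mapping_def Abs_poly_mapping_inverse
      finite_subset[OF _ finite_lookup])

lemma lookup_vec_of: "Poly_Mapping.lookup (vec_of n f) j = (if j < n then f j else 0)"
  by (simp add: vec_of_def lookup_sum lookup_single when_def)

lemma sum_lessThan_add:
  "(\<Sum>k<m + n. f k) = (\<Sum>k<m. f k) + (\<Sum>k<n. f (m + k) :: real)" for m n :: nat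
  by (induction n) (auto simp: algebra_simps)

lemma split_vec_isometry:
  fixes r s :: nat
  defines "i \<equiv> min r s"
  assumes "split_vec r s v = (u, x)" "split_vec r s w = (u', x')"
  shows "gform r s v w = gform i i u u' + gform (r - i) (s - i) x x'"
proof -
  have r: "r = i + (r - i)" and s: "s = i + (s - i)" by (auto simp: i_def)
  have n: "r + s - 2 * i = (r - i) + (s - i)" by (auto simp: i_def)
  have u: "u = vec_of (2 * i) (\<lambda>k. if k < i then Poly_Mapping.lookup v k
                          else Poly_Mapping.lookup v (r + (k - i)))"
    and u': "u' = vec_of (2 * i) (\<lambda>k. if k < i then Poly_Mapping.lookup w k
                          else Poly_Mapping.lookup w (r + (k - i)))"
    and x: "x = vec_of (r - i + (s - i)) (\<lambda>k. if k < r - i then Poly_Mapping.lookup v (i + k)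
                          else Poly_Mapping.lookup v (r + i + (k - (r - i))))"
    and x': "x' = vec_of (r - i + (s - i)) (\<lambda>k. if k < r - i then Poly_Mapping.lookup w (i + k)
                          else Poly_Mapping.lookup w (r + i + (k - (r - i))))"
    using assms(2,3) by (auto simp: split_vec_def Let_def n simp flip: i_def)
  have "(\<Sum>k<r. Poly_Mapping.lookup v k * Poly_Mapping.lookup w k) =
      (\<Sum>k<i. Poly_Mapping.lookup u k * Poly_Mapping.lookup u' k) +
      (\<Sum>k<r - i. Poly_Mapping.lookup x k * Poly_Mapping.lookup x' k)"
    by (subst r, subst sum_lessThan_add, intro arg_cong2[of _ _ _ _ "(+)"] sum.cong)
      (auto simp: u u' x x' lookup_vec_of)
  moreover have "(\<Sum>k<s. Poly_Mapping.lookup v (r + k) * Poly_Mapping.lookup w (r + k)) =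
      (\<Sum>k<i. Poly_Mapping.lookup u (i + k) * Poly_Mapping.lookup u' (i + k)) +
      (\<Sum>k<s - i. Poly_Mapping.lookup x (r - i + k) * Poly_Mapping.lookup x' (r - i + k))"
    by (subst s, subst sum_lessThan_add, intro arg_cong2[of _ _ _ _ "(+)"] sum.cong)
      (auto simp: u u' x x' lookup_vec_of add.assoc)
  ultimately show ?thesis by (simp add: gform_def)
qed

lemma split_vec_bij:
  fixes r s :: nat
  defines "i \<equiv> min r s"
  shows "bij_betw (split_vec r s) (Rn (r + s)) (Rn (2 * i) \<times> Rn ((r - i) + (s - i)))"
proof -
  define j where "j = (\<lambda>(u, x). vec_of (r + s) (\<lambda>k.
     if k < i then Poly_Mapping.lookup u k
     else if k < r then Poly_Mapping.lookup x (k - i)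
     else if k < r + i then Poly_Mapping.lookup u (i + (k - r))
     else Poly_Mapping.lookup x (r - i + (k - (r + i)))))"
  have i: "i \<le> r" "i \<le> s" by (auto simp: i_def)
  show ?thesis
  proof (rule bij_betw_byWitness[where f' = j])
    show "\<forall>v\<in>Rn (r + s). j (split_vec r s v) = v"
      using i by (auto intro!: poly_mapping_eqI
          simp: j_def split_vec_def Let_def lookup_vec_of Rn_def simp flip: i_def)
    show "\<forall>p\<in>Rn (2 * i) \<times> Rn ((r - i) + (s - i)). split_vec r s (j p) = p"
      using i by (auto intro!: poly_mapping_eqI
          simp: j_def split_vec_def Let_def lookup_vec_of Rn_def simp flip: i_def)
    show "split_vec r s ` Rn (r + s) \<subseteq> Rn (2 * i) \<times> Rn ((r - i) + (s - i))"
      using i by (auto simp: split_vec_def Let_def lookup_vec_of Rn_def simp flip: i_def)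
    show "j ` (Rn (2 * i) \<times> Rn ((r - i) + (s - i))) \<subseteq> Rn (r + s)"
      by (auto simp: j_def lookup_vec_of Rn_def)
  qed
qed


section \<open>Tensor products of real vector spaces\<close>

definition tensor_relations :: "(('a::real_vector \<times> 'b::real_vector) \<Rightarrow>\<^sub>0 real) set" where
  "tensor_relations =
     {Poly_Mapping.single (x + x', y) 1 -
        (Poly_Mapping.single (x, y) 1 + Poly_Mapping.single (x', y) 1) | x x' y. True} \<union>
     {Poly_Mapping.single (x, y + y') 1 -
        (Poly_Mapping.single (x, y) 1 + Poly_Mapping.single (x, y') 1) | x y y'. True} \<union>
     {Poly_Mapping.single (t *\<^sub>R x, y) 1 - t *\<^sub>R Poly_Mapping.single (x, y) 1 | t x y. True} \<union>
     {Poly_Mapping.single (x, t *\<^sub>R y) 1 - t *\<^sub>R Poly_Mapping.single (x, y) 1 | t x y. True}"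

quotient_type (overloaded) ('a, 'b) tensor = "('a::real_vector \<times> 'b::real_vector) \<Rightarrow>\<^sub>0 real" /
  "\<lambda>p q. p - q \<in> span tensor_relations"
proof (rule equivpI)
  show "reflp (\<lambda>p q :: ('a \<times> 'b) \<Rightarrow>\<^sub>0 real. p - q \<in> span tensor_relations)"
    by (auto intro!: reflpI span_zero)
  show "symp (\<lambda>p q :: ('a \<times> 'b) \<Rightarrow>\<^sub>0 real. p - q \<in> span tensor_relations)"
    by (metis (no_types, lifting) minus_diff_eq span_neg sympI)
  show "transp (\<lambda>p q :: ('a \<times> 'b) \<Rightarrow>\<^sub>0 real. p - q \<in> span tensor_relations)"
  proof (rule transpI)
    fix p q u :: "('a \<times> 'b) \<Rightarrow>\<^sub>0 real"
    assume "p - q \<in> span tensor_relations" "q - u \<in> span tensor_relations"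
    from span_add[OF this] show "p - u \<in> span tensor_relations" by simp
  qed
qed

instantiation tensor :: (real_vector, real_vector) real_vector
begin

lift_definition zero_tensor :: "('a, 'b) tensor" is 0 .

lift_definition plus_tensor :: "('a, 'b) tensor \<Rightarrow> ('a, 'b) tensor \<Rightarrow> ('a, 'b) tensor" is "(+)"
proof -
  fix p q p' q' :: "('a \<times> 'b) \<Rightarrow>\<^sub>0 real"
  assume "p - q \<in> span tensor_relations" "p' - q' \<in> span tensor_relations"
  from span_add[OF this] show "p + p' - (q + q') \<in> span tensor_relations"
    by (simp add: algebra_simps)
qed

lift_definition uminus_tensor :: "('a, 'b) tensor \<Rightarrow> ('a, 'b) tensor" is uminus
proof -
  fix p q :: "('a \<times> 'b) \<Rightarrow>\<^sub>0 real"
  assume "p - q \<in> span tensor_relations"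
  from span_neg[OF this] show "- p - - q \<in> span tensor_relations"
    by (simp add: algebra_simps)
qed

lift_definition minus_tensor :: "('a, 'b) tensor \<Rightarrow> ('a, 'b) tensor \<Rightarrow> ('a, 'b) tensor" is "(-)"
proof -
  fix p q p' q' :: "('a \<times> 'b) \<Rightarrow>\<^sub>0 real"
  assume "p - q \<in> span tensor_relations" "p' - q' \<in> span tensor_relations"
  from span_diff[OF this] show "p - p' - (q - q') \<in> span tensor_relations"
    by (simp add: algebra_simps)
qed

lift_definition scaleR_tensor :: "real \<Rightarrow> ('a, 'b) tensor \<Rightarrow> ('a, 'b) tensor" is scaleR
proof -
  fix t :: real and p q :: "('a \<times> 'b) \<Rightarrow>\<^sub>0 real"
  assume "p - q \<in> span tensor_relations"
  from span_scale[OF this] show "t *\<^sub>R p - t *\<^sub>R q \<in> span tensor_relations"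
    by (simp add: scaleR_diff_right)
qed

instance
  by standard (transfer, simp add: algebra_simps span_zero)+

end

lift_definition tens :: "'a::real_vector \<Rightarrow> 'b::real_vector \<Rightarrow> ('a, 'b) tensor"
  is "\<lambda>x y. Poly_Mapping.single (x, y) 1" .

text \<open>The operator \<open>f \<otimes> h\<close>, for linear \<open>f\<close> and \<open>h\<close>.\<close>

definition tensor_map ::
    "('a::real_vector \<Rightarrow> 'a) \<Rightarrow> ('b::real_vector \<Rightarrow> 'b) \<Rightarrow> ('a, 'b) tensor \<Rightarrow> ('a, 'b) tensor" where
  "tensor_map f h = (THE F. linear F \<and> (\<forall>x y. F (tens x y) = tens (f x) (h y)))"

text \<open>The operator \<open>I\<close> \<open>\<otimes>\<close>-hat \<open>T\<close>, for a grading \<open>(Mp, Mm)\<close> and linear \<open>T\<close>.\<close>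

definition graded_tensor_map ::
    "'a::real_vector set \<Rightarrow> 'a set \<Rightarrow> ('b::real_vector \<Rightarrow> 'b) \<Rightarrow>
      ('a, 'b) tensor \<Rightarrow> ('a, 'b) tensor" where
  "graded_tensor_map Mp Mm T = (THE F. linear F \<and>
     (\<forall>x\<in>Mp. \<forall>y. F (tens x y) = tens x (T y)) \<and>
     (\<forall>x\<in>Mm. \<forall>y. F (tens x y) = - tens x (T y)))"

lemma tens_add_left: "tens (x + x') y = tens x y + tens x' y"
  by transfer (rule span_base, unfold tensor_relations_def, blast)

lemma tens_add_right: "tens x (y + y') = tens x y + tens x y'"
  by transfer (rule span_base, unfold tensor_relations_def, blast)

lemma tens_scale_left: "tens (t *\<^sub>R x) y = t *\<^sub>R tens x y"
  by transfer (rule span_base, unfold tensor_relations_def, blast)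

lemma tens_scale_right: "tens x (t *\<^sub>R y) = t *\<^sub>R tens x y"
  by transfer (rule span_base, unfold tensor_relations_def, blast)

lemma lookup_scaleR_real:
  "Poly_Mapping.lookup (t *\<^sub>R p) k = t * Poly_Mapping.lookup (p :: 'x \<Rightarrow>\<^sub>0 real) k"
  by (simp add: scaleR_poly_mapping_def Abs_poly_mapping_inverse
      finite_subset[OF _ finite_lookup[of p]])

lemma poly_mapping_eq_sum:
  "p = (\<Sum>k\<in>Poly_Mapping.keys p. Poly_Mapping.lookup p k *\<^sub>R
          Poly_Mapping.single k (1::real))" (is "p = ?q")
proof (rule poly_mapping_eqI)
  fix j
  have "Poly_Mapping.lookup ?q j =
      (\<Sum>k\<in>Poly_Mapping.keys p. if k = j then Poly_Mapping.lookup p j else 0)"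
    unfolding lookup_sum
    by (rule sum.cong) (auto simp: lookup_scaleR_real lookup_single when_def)
  also have "\<dots> = Poly_Mapping.lookup p j" by (simp add: in_keys_iff)
  finally show "Poly_Mapping.lookup p j = Poly_Mapping.lookup ?q j" by simp
qed

lemma span_tens: "span (range (\<lambda>(x, y). tens x y)) = UNIV"
proof -
  have mem: "tens a b \<in> range (\<lambda>(x, y). tens x y)" for a :: 'a and b :: 'b
    using rangeI[of "\<lambda>(x, y). tens x y" "(a, b)"] by simp
  have "abs_tensor p \<in> span (range (\<lambda>(x, y). tens x y))" for p :: "('a \<times> 'b) \<Rightarrow>\<^sub>0 real"
  proof -
    have lin: "linear (abs_tensor :: (('a \<times> 'b) \<Rightarrow>\<^sub>0 real) \<Rightarrow> _)"
      by (auto intro!: linearI simp: plus_tensor.abs_eq scaleR_tensor.abs_eq)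
    have "abs_tensor p = (\<Sum>k\<in>Poly_Mapping.keys p. Poly_Mapping.lookup p k *\<^sub>R
        abs_tensor (Poly_Mapping.single k 1))"
      by (subst poly_mapping_eq_sum) (simp add: linear_sum[OF lin] linear_scale[OF lin])
    also have "\<dots> \<in> span (range (\<lambda>(x, y). tens x y))"
      by (intro span_sum span_scale span_base) (auto simp: mem simp flip: tens.abs_eq)
    finally show ?thesis .
  qed
  then have "t \<in> span (range (\<lambda>(x, y). tens x y))" for t :: "('a, 'b) tensor"
    by (induction t rule: tensor.abs_induct)
  then show ?thesis by blast
qed

lemma tensor_linear_unique:
  fixes F H :: "('a::real_vector, 'b::real_vector) tensor \<Rightarrow> 'c::real_vector"
  assumes "linear F" "linear H" "\<And>x y. F (tens x y) = H (tens x y)"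
  shows "F = H"
proof
  fix t :: "('a, 'b) tensor"
  have "t \<in> span (range (\<lambda>(x, y). tens x y))" by (simp add: span_tens)
  then show "F t = H t"
    by (rule linear_eq_on[OF assms(1,2)]) (auto simp: assms(3))
qed

text \<open>The universal property.\<close>

lemma tensor_universal:
  fixes B :: "'a::real_vector \<Rightarrow> 'b::real_vector \<Rightarrow> 'c::real_vector"
  assumes "\<And>y. linear (\<lambda>x. B x y)" "\<And>x. linear (B x)"
  obtains F where "linear F" "\<And>x y. F (tens x y) = B x y"
proof -
  define E where "E p = (\<Sum>k\<in>Poly_Mapping.keys p.
      Poly_Mapping.lookup p k *\<^sub>R B (fst k) (snd k))" for p :: "('a \<times> 'b) \<Rightarrow>\<^sub>0 real"
  have E: "E p = (\<Sum>k\<in>K. Poly_Mapping.lookup p k *\<^sub>R B (fst k) (snd k))"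
    if "finite K" "Poly_Mapping.keys p \<subseteq> K" for p K
    unfolding E_def using that by (intro sum.mono_neutral_left) (auto simp: in_keys_iff)
  have lin: "linear E"
  proof (rule linearI)
    fix p q :: "('a \<times> 'b) \<Rightarrow>\<^sub>0 real"
    let ?K = "Poly_Mapping.keys p \<union> Poly_Mapping.keys q"
    show "E (p + q) = E p + E q"
      using Poly_Mapping.keys_add[of p q]
      by (simp add: E[of ?K] lookup_add scaleR_add_left sum.distrib)
  next
    fix t :: real and p :: "('a \<times> 'b) \<Rightarrow>\<^sub>0 real"
    have "Poly_Mapping.keys (t *\<^sub>R p) \<subseteq> Poly_Mapping.keys p"
      by (auto simp: in_keys_iff lookup_scaleR_real)
    then show "E (t *\<^sub>R p) = t *\<^sub>R E p"
      by (simp add: E[of "Poly_Mapping.keys p"] lookup_scaleR_real scaleR_sum_right)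
  qed
  have E1: "E (Poly_Mapping.single (x, y) 1) = B x y" for x y by (simp add: E_def)
  have rel: "E p = 0" if "p \<in> tensor_relations" for p
    using that unfolding tensor_relations_def
    by (auto simp: linear_diff[OF lin] linear_add[OF lin] linear_scale[OF lin] E1
        linear_add[OF assms(1)] linear_add[OF assms(2)] linear_scale[OF assms(1)]
        linear_scale[OF assms(2)])
  have "E p = 0" if "p \<in> span tensor_relations" for p
    using linear_eq_on[OF lin _ that, of "\<lambda>_. 0"] rel by (simp add: linear_zero)
  then have wd: "E p = E q" if "p - q \<in> span tensor_relations" for p q
    using that by (metis eq_iff_diff_eq_0 lin linear_diff)
  define F where "F t = E (rep_tensor t)" for t
  have F: "F (abs_tensor p) = E p" for p
    unfolding F_def
    by (rule wd, rule iffD1[OF tensor.abs_eq_iff]) (rule Quotient3_abs_rep[OF Quotient3_tensor])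
  show ?thesis
  proof
    show "linear F"
    proof (rule linearI)
      fix a b :: "('a, 'b) tensor" and t
      obtain p q where pq: "a = abs_tensor p" "b = abs_tensor q"
        using Quotient3_abs_rep[OF Quotient3_tensor] by metis
      show "F (a + b) = F a + F b"
        by (simp add: pq plus_tensor.abs_eq F linear_add[OF lin])
      show "F (t *\<^sub>R a) = t *\<^sub>R F a"
        by (simp add: pq scaleR_tensor.abs_eq F linear_scale[OF lin])
    qed
    show "F (tens x y) = B x y" for x y by (simp add: tens.abs_eq F E1)
  qed
qed

lemma tensor_map:
  assumes "linear f" "linear h"
  shows "linear (tensor_map f h)" "tensor_map f h (tens x y) = tens (f x) (h y)"
proof -
  have "\<exists>F. linear F \<and> (\<forall>x y. F (tens x y) = tens (f x) (h y))"
    by (rule tensor_universal[of "\<lambda>x y. tens (f x) (h y)"])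
      (auto intro!: linearI simp: linear_add[OF assms(1)] linear_add[OF assms(2)]
        linear_scale[OF assms(1)] linear_scale[OF assms(2)]
        tens_add_left tens_add_right tens_scale_left tens_scale_right)
  then have "\<exists>!F. linear F \<and> (\<forall>x y. F (tens x y) = tens (f x) (h y))"
    by (metis (no_types, lifting) tensor_linear_unique)
  from theI'[OF this] show "linear (tensor_map f h)" "tensor_map f h (tens x y) = tens (f x) (h y)"
    by (auto simp: tensor_map_def)
qed

lemma graded_tensor_map:
  assumes "Z2_grading Mp Mm" "linear T"
  shows "linear (graded_tensor_map Mp Mm T)"
    "x \<in> Mp \<Longrightarrow> graded_tensor_map Mp Mm T (tens x y) = tens x (T y)"
    "x \<in> Mm \<Longrightarrow> graded_tensor_map Mp Mm T (tens x y) = - tens x (T y)"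
proof -
  let ?P = "\<lambda>F. linear F \<and> (\<forall>x\<in>Mp. \<forall>y. F (tens x y) = tens x (T y)) \<and>
     (\<forall>x\<in>Mm. \<forall>y. F (tens x y) = - tens x (T y))"
  have sub: "subspace Mp" "subspace Mm" and int: "Mp \<inter> Mm = {0}"
    and ex: "\<And>x. \<exists>p\<in>Mp. \<exists>q\<in>Mm. x = p + q"
    using assms(1) by (auto simp: Z2_grading_def)
  obtain P Q where PQ: "\<And>x. P x \<in> Mp" "\<And>x. Q x \<in> Mm" "\<And>x. x = P x + Q x"
    using ex by metis
  have uniq: "p = p' \<and> q = q'" if "p + q = p' + q'" "p \<in> Mp" "p' \<in> Mp" "q \<in> Mm" "q' \<in> Mm"
    for p q p' q'
  proof -
    have eq: "p - p' = q' - q" using that(1) by (simp add: algebra_simps)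
    have "p - p' \<in> Mp" using that sub by (simp add: subspace_diff)
    moreover have "p - p' \<in> Mm" unfolding eq using that sub by (simp add: subspace_diff)
    ultimately have "p - p' = 0" using int by blast
    then show ?thesis using eq by simp
  qed
  define e where "e x = P x - Q x" for x
  have e: "e (p + q) = p - q" if "p \<in> Mp" "q \<in> Mm" for p q
  proof -
    have "P (p + q) = p \<and> Q (p + q) = q"
      by (rule uniq[OF PQ(3)[of "p + q", symmetric]]) (auto simp: PQ(1,2) that)
    then show ?thesis by (simp add: e_def)
  qed
  have lin: "linear e"
  proof (rule linearI)
    fix x y :: 'a and t :: real
    have "e ((P x + P y) + (Q x + Q y)) = (P x + P y) - (Q x + Q y)"
      by (rule e) (auto simp: PQ subspace_add sub)
    moreover have "(P x + P y) + (Q x + Q y) = x + y"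
      using PQ(3)[of x] PQ(3)[of y] by (metis add.assoc add.left_commute)
    ultimately show "e (x + y) = e x + e y" by (simp add: e_def)
    have "e (t *\<^sub>R P x + t *\<^sub>R Q x) = t *\<^sub>R P x - t *\<^sub>R Q x"
      by (rule e) (auto simp: PQ subspace_scale sub)
    then show "e (t *\<^sub>R x) = t *\<^sub>R e x"
      using PQ(3)[of x] by (metis e_def scaleR_add_right scaleR_diff_right)
  qed
  have e_plus: "e x = x" if "x \<in> Mp" for x
    using e[of x 0] that sub by (simp add: subspace_0)
  have e_minus: "e x = - x" if "x \<in> Mm" for x
    using e[of 0 x] that sub by (simp add: subspace_0)
  have neg: "tens (- x) y = - tens x y" for x :: 'a and y :: 'b
    using tens_scale_left[of "-1" x y] by simp
  have ex1: "?P (tensor_map e T)"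
    using tensor_map[OF lin assms(2)] by (simp add: e_plus e_minus neg)
  have unique: "F = tensor_map e T" if F: "?P F" for F
  proof (rule tensor_linear_unique)
    show "linear F" using F by blast
    show "linear (tensor_map e T)" using ex1 by blast
    fix x y
    have "F (tens (P x + Q x) y) = tensor_map e T (tens (P x + Q x) y)"
      using F ex1 PQ(1,2)
      by (simp add: tens_add_left linear_add[of F] linear_add[of "tensor_map e T"])
    then show "F (tens x y) = tensor_map e T (tens x y)" by (metis PQ(3))
  qed
  have "graded_tensor_map Mp Mm T = tensor_map e T"
    unfolding graded_tensor_map_def by (rule the_equality) (use ex1 unique in blast)+
  then show "linear (graded_tensor_map Mp Mm T)"
    "x \<in> Mp \<Longrightarrow> graded_tensor_map Mp Mm T (tens x y) = tens x (T y)"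
    "x \<in> Mm \<Longrightarrow> graded_tensor_map Mp Mm T (tens x y) = - tens x (T y)"
    using ex1 by auto
qed

definition product_clifford_map ::
    "nat \<Rightarrow> nat \<Rightarrow> ((nat \<Rightarrow>\<^sub>0 real) \<Rightarrow> 'a \<Rightarrow> 'a::real_vector) \<Rightarrow> 'a set \<Rightarrow> 'a set \<Rightarrow>
      ((nat \<Rightarrow>\<^sub>0 real) \<Rightarrow> 'b \<Rightarrow> 'b::real_vector) \<Rightarrow>
      (nat \<Rightarrow>\<^sub>0 real) \<Rightarrow> ('a, 'b) tensor \<Rightarrow> ('a, 'b) tensor" where
  "product_clifford_map r s c Mp Mm d w = (case split_vec r s w of (u, v) \<Rightarrow>
     (\<lambda>t. tensor_map (c u) id t + graded_tensor_map Mp Mm (d v) t))"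


section \<open>The algebras \<open>Cl\<^bsub>r,s\<^esub>\<close>\<close>

type_synonym cl = "(nat \<Rightarrow>\<^sub>0 real) clifford"

abbreviation "Cl_irreducible r s \<equiv> irreducible_clifford_module (Rn (r + s)) (gform r s)"
abbreviation "Cl_isomorphic r s \<equiv> isomorphic_clifford_modules (Rn (r + s)) (gform r s)"
abbreviation "Cl_graded_module r s \<equiv> graded_clifford_module (Rn (r + s)) (gform r s)"
abbreviation "Cl_map r s \<equiv> module_map (Rn (r + s)) (gform r s)"
abbreviation "Cl_has_map r s \<equiv> has_clifford_map (Rn (r + s)) (gform r s)"
abbreviation "Cl_condition r s \<equiv> clifford_condition (Rn (r + s)) (gform r s)"

end

theory Submission
  imports Defs
begin

text \<open>
  A module over a Clifford algebra is the same thing as a Clifford map, and submodules and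
  intertwiners can be tested on vectors (\<open>clifford_module_eq_free_action\<close>,
  \<open>clifford_module_exists\<close>). This reduces the theorem to statements about anticommuting operators.

  Uniqueness. Let two irreducible modules over \<open>Cl\<^bsub>r,s\<^esub>\<close> be given. If \<open>n = r + s\<close> is even, the
  volume element anticommutes with all vectors, and any nonzero linear map between the modules
  can be turned, basis vector by basis vector, into a nonzero intertwiner
  (\<open>exists_intertwiner\<close>); by Schur's lemma the modules are isomorphic. If \<open>n\<close> is odd, the volume
  element is central, and the same procedure applied to \<open>n - 1\<close> basis vectors works as soon as
  the initial map commutes with the volume elements (\<open>odd_intertwiner\<close>). When the volume element has
  square \<open>-1\<close> such a map always exists. When it has square \<open>1\<close>, which for odd \<open>n\<close> happens exactly
  if \<open>r - s \<equiv> 1 (mod 4)\<close>, it acts on each irreducible module by a sign. The sign determines the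
  module, and changing the sign of the Clifford map changes it, so there are exactly two classes.

  Products. In \<open>Cl\<^bsub>i,i\<^esub>\<close> the products of the \<open>k\<close>-th negative and the \<open>k\<close>-th positive basis vector
  are commuting involutions, and they commute with the vectors of the other summand. Their
  common fixed vectors in \<open>S\<^bsub>i,i\<^esub> \<otimes> N\<close> are the tensors \<open>x0 \<otimes> y\<close> for one homogeneous \<open>x0\<close>
  (\<open>fixed_tensor\<close>), a copy of \<open>N\<close> up to a sign of the Clifford map. Every nonzero submodule meets
  this copy (\<open>exists_fixed_vector\<close>), so the product is irreducible when \<open>N\<close> is
  (\<open>product_irreducible\<close>), and isomorphic products come from isomorphic right factors
  (\<open>product_intertwiner\<close>). Since \<open>r - s\<close> does not change when \<open>i\<close> is subtracted from both, the
  uniqueness results for \<open>N\<close> and for the product match.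
\<close>

section \<open>Clifford modules as Clifford maps\<close>

text \<open>
  The representation of the free algebra extending a map on letters.
\<close>

definition free_action ::
    "('v \<Rightarrow> 'a \<Rightarrow> 'a) \<Rightarrow> ('v free_monoid \<Rightarrow>\<^sub>0 real) \<Rightarrow> 'a \<Rightarrow> 'a::real_vector" where
  "free_action c p x = (\<Sum>k\<in>Poly_Mapping.keys p.
     Poly_Mapping.lookup p k *\<^sub>R (case k of Word w \<Rightarrow> foldr c w x))"

lemma free_action_superset:
  assumes "finite K" "Poly_Mapping.keys p \<subseteq> K"
  shows "free_action c p x =
    (\<Sum>k\<in>K. Poly_Mapping.lookup p k *\<^sub>R (case k of Word w \<Rightarrow> foldr c w x))"
  unfolding free_action_def using assms
  by (intro sum.mono_neutral_left) (auto simp: in_keys_iff)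

lemma free_action_add: "free_action c (p + q) x = free_action c p x + free_action c q x"
proof -
  let ?K = "Poly_Mapping.keys p \<union> Poly_Mapping.keys q"
  show ?thesis
    using Poly_Mapping.keys_add[of p q]
    by (simp add: free_action_superset[of ?K] lookup_add scaleR_add_left sum.distrib)
qed

lemma free_action_scale: "free_action c (t *\<^sub>R p) x = t *\<^sub>R free_action c p x"
proof -
  have "Poly_Mapping.keys (t *\<^sub>R p) \<subseteq> Poly_Mapping.keys p"
    by (auto simp: in_keys_iff lookup_scaleR_real)
  then show ?thesis
    by (simp add: free_action_superset[of "Poly_Mapping.keys p"] lookup_scaleR_real scaleR_sum_right)
qed

lemma free_action_zero [simp]: "free_action c 0 x = 0"
  by (simp add: free_action_def)

lemma free_action_diff: "free_action c (p - q) x = free_action c p x - free_action c q x"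
  using free_action_add[of c p "-1 *\<^sub>R q" x] free_action_scale[of c "-1" q x] by simp

lemma free_action_sum: "free_action c (sum f K) x = (\<Sum>k\<in>K. free_action c (f k) x)"
  by (induction K rule: infinite_finite_induct) (auto simp: free_action_add)

lemma free_action_single [simp]:
  "free_action c (Poly_Mapping.single (Word w) t) x = t *\<^sub>R foldr c w x"
  by (simp add: free_action_def)

lemma free_action_one [simp]: "free_action c 1 x = x"
proof -
  have "(1 :: 'b free_monoid \<Rightarrow>\<^sub>0 real) = Poly_Mapping.single (Word []) 1"
    by (simp flip: single_one add: zero_free_monoid_def)
  then show ?thesis by (metis free_action_single foldr_Nil id_apply scaleR_one)
qed

lemma free_action_letter [simp]: "free_action c (letter v) x = c v x"
  by (simp add: letter_def)

lemma word_keyE: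
  assumes "k \<in> Poly_Mapping.keys p" "Poly_Mapping.keys p \<subseteq> Word ` lists V"
  obtains w where "w \<in> lists V" "k = Word w"
  using assms by blast

lemma linear_foldr:
  assumes "\<And>v. v \<in> V \<Longrightarrow> linear (c v)" "w \<in> lists V"
  shows "linear (foldr c w)"
  using assms(2)
proof induction
  case Nil
  show ?case using linear_id by (simp add: id_def)
next
  case (Cons v w)
  then show ?case using linear_compose[of "foldr c w" "c v"] assms(1) by (simp add: o_def)
qed

lemma poly_mapping_sum_single:
  "p = (\<Sum>k\<in>Poly_Mapping.keys p. Poly_Mapping.single k (Poly_Mapping.lookup p k))"
proof (rule poly_mapping_eqI)
  fix j
  have "Poly_Mapping.lookup (\<Sum>k\<in>Poly_Mapping.keys p. Poly_Mapping.single k (Poly_Mapping.lookup p k)) j =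
      (\<Sum>k\<in>Poly_Mapping.keys p. if k = j then Poly_Mapping.lookup p j else 0)"
    unfolding lookup_sum by (rule sum.cong) (auto simp: lookup_single when_def)
  also have "\<dots> = Poly_Mapping.lookup p j" by (simp add: in_keys_iff)
  finally show "Poly_Mapping.lookup p j =
    Poly_Mapping.lookup (\<Sum>k\<in>Poly_Mapping.keys p. Poly_Mapping.single k (Poly_Mapping.lookup p k)) j"
    by simp
qed

text \<open>
  Linearity of the letters of the left factor moves them past the linear combination of words
  that the right factor produces.
\<close>

lemma free_action_mult:
  assumes lin: "\<And>v. v \<in> V \<Longrightarrow> linear (c v)" and p: "Poly_Mapping.keys p \<subseteq> Word ` lists V"
  shows "free_action c (p * q) x = free_action c p (free_action c q x)"
proof -
  have word: "free_action c (Poly_Mapping.single (Word w) t * q) x =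
      t *\<^sub>R foldr c w (free_action c q x)" if w: "w \<in> lists V" for w t
  proof -
    have l: "linear (foldr c w)" by (rule linear_foldr[OF lin w])
    have "Poly_Mapping.single (Word w) t * q =
        (\<Sum>k\<in>Poly_Mapping.keys q. Poly_Mapping.single (Word w + k) (t * Poly_Mapping.lookup q k))"
      by (subst poly_mapping_sum_single[of q]) (simp add: sum_distrib_left mult_single)
    also have "free_action c \<dots> x = (\<Sum>k\<in>Poly_Mapping.keys q. t *\<^sub>R foldr c w
        (Poly_Mapping.lookup q k *\<^sub>R (case k of Word u \<Rightarrow> foldr c u x)))"
      unfolding free_action_sum
      by (rule sum.cong) (auto split: free_monoid.split simp: linear_scale[OF l])
    also have "\<dots> = t *\<^sub>R foldr c w (free_action c q x)"
      unfolding free_action_def by (simp add: linear_sum[OF l] scaleR_sum_right)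
    finally show ?thesis .
  qed
  have "p * q = (\<Sum>k\<in>Poly_Mapping.keys p. Poly_Mapping.single k (Poly_Mapping.lookup p k) * q)"
    by (subst poly_mapping_sum_single[of p]) (simp add: sum_distrib_right)
  also have "free_action c \<dots> x = (\<Sum>k\<in>Poly_Mapping.keys p.
      Poly_Mapping.lookup p k *\<^sub>R (case k of Word w \<Rightarrow> foldr c w (free_action c q x)))"
    unfolding free_action_sum
    by (intro sum.cong refl, erule word_keyE[OF _ p]) (simp add: word)
  also have "\<dots> = free_action c p (free_action c q x)" by (simp add: free_action_def[of c p])
  finally show ?thesis .
qed

lemma free_algebra_simps [simp]:
  "carrier (free_algebra V) = {p. Poly_Mapping.keys p \<subseteq> Word ` lists V}"
  "x \<otimes>\<^bsub>free_algebra V\<^esub> y = x * y" "x \<oplus>\<^bsub>free_algebra V\<^esub> y = x + y"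
  "\<one>\<^bsub>free_algebra V\<^esub> = 1" "\<zero>\<^bsub>free_algebra V\<^esub> = 0"
  by (simp_all add: free_algebra_def)

lemma End_ring_simps [simp]:
  "carrier End_ring = {f. linear f}" "f \<otimes>\<^bsub>End_ring\<^esub> h = f \<circ> h"
  "f \<oplus>\<^bsub>End_ring\<^esub> h = (\<lambda>x. f x + h x)" "\<one>\<^bsub>End_ring\<^esub> = id" "\<zero>\<^bsub>End_ring\<^esub> = (\<lambda>x. 0)"
  by (simp_all add: End_ring_def)

lemma End_ring_ring: "ring (End_ring :: ('a::real_vector \<Rightarrow> 'a) ring)"
proof (rule ringI)
  show "abelian_group (End_ring :: ('a \<Rightarrow> 'a) ring)"
  proof (rule abelian_groupI)
    fix f :: "'a \<Rightarrow> 'a" assume "f \<in> carrier End_ring"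
    then show "\<exists>h\<in>carrier End_ring. h \<oplus>\<^bsub>End_ring\<^esub> f = \<zero>\<^bsub>End_ring\<^esub>"
      by (intro bexI[of _ "\<lambda>x. - f x"]) (auto simp: linear_compose_neg)
  qed (auto simp: linear_compose_add linear_zero algebra_simps)
  show "Group.monoid (End_ring :: ('a \<Rightarrow> 'a) ring)"
    by (rule monoidI) (auto simp: linear_id o_assoc intro: linear_compose)
qed (auto simp: linear_add)

lemma linear_free_action:
  assumes "\<And>v. v \<in> V \<Longrightarrow> linear (c v)" "Poly_Mapping.keys p \<subseteq> Word ` lists V"
  shows "linear (free_action c p)"
proof -
  have "linear (\<lambda>x. Poly_Mapping.lookup p k *\<^sub>R (case k of Word w \<Rightarrow> foldr c w x))"
    if k: "k \<in> Poly_Mapping.keys p" for k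
  proof -
    obtain w where w: "w \<in> lists V" "k = Word w" using word_keyE[OF k assms(2)] by blast
    show ?thesis using linear_compose_scale_right[OF linear_foldr[OF assms(1) w(1)]]
      by (simp add: w(2))
  qed
  then show ?thesis unfolding free_action_def[abs_def] by (intro linear_compose_sum) auto
qed

lemma free_action_hom:
  assumes "\<And>v. v \<in> V \<Longrightarrow> linear (c v)"
  shows "free_action c \<in> ring_hom (free_algebra V) End_ring"
  by (rule ring_hom_memI)
    (simp_all add: linear_free_action[where V=V and c=c, OF assms] free_action_mult[where V=V and c=c, OF assms]
      free_action_add fun_eq_iff)

lemma clifford_ideal_ideal: "subspace V \<Longrightarrow> ideal (clifford_ideal V g) (free_algebra V)"
  unfolding clifford_ideal_def
  by (rule ring.genideal_ideal[OF free_algebra_ring clifford_relations_subset])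

lemma clifford_relation_in_ideal:
  assumes "subspace V" "p \<in> clifford_relations V g"
  shows "p \<in> clifford_ideal V g"
  unfolding clifford_ideal_def
  using ring.genideal_self[OF free_algebra_ring clifford_relations_subset[OF assms(1)]] assms(2)
  by blast

lemma carrier_clifford_algebra:
  "carrier (clifford_algebra V g) =
    (\<lambda>p. clifford_ideal V g +>\<^bsub>free_algebra V\<^esub> p) ` carrier (free_algebra V)"
  by (auto simp: clifford_algebra_def FactRing_def A_RCOSETS_def')

lemma clifford_module_pullback:
  assumes "subspace V" "clifford_module V g \<rho>"
  shows "(\<lambda>p. \<rho> (clifford_ideal V g +>\<^bsub>free_algebra V\<^esub> p)) \<in> ring_hom (free_algebra V) End_ring"
proof -
  have "(+>\<^bsub>free_algebra V\<^esub>) (clifford_ideal V g) \<in>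
      ring_hom (free_algebra V) (clifford_algebra V g)"
    unfolding clifford_algebra_def by (rule ideal.rcos_ring_hom[OF clifford_ideal_ideal[OF assms(1)]])
  then have "\<rho> \<circ> (+>\<^bsub>free_algebra V\<^esub>) (clifford_ideal V g) \<in> ring_hom (free_algebra V) End_ring"
    by (rule ring_hom_trans) (use assms(2) in \<open>simp add: clifford_module_def\<close>)
  then show ?thesis by (simp add: o_def)
qed

text \<open>
  The Clifford algebra is generated by its scalars and vectors, so the Clifford map determines
  the whole action. Irreducibility and isomorphism of modules can therefore be tested on
  vectors alone.
\<close>

lemma clifford_module_eq_free_action:
  assumes V: "subspace V" and \<rho>: "clifford_module V g \<rho>"
    and p: "Poly_Mapping.keys p \<subseteq> Word ` lists V"
  shows "\<rho> (clifford_ideal V g +>\<^bsub>free_algebra V\<^esub> p) = free_action (module_map V g \<rho>) p"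
proof -
  define h where "h p = \<rho> (clifford_ideal V g +>\<^bsub>free_algebra V\<^esub> p)" for p
  have hom: "h \<in> ring_hom (free_algebra V) End_ring"
    unfolding h_def[abs_def] by (rule clifford_module_pullback[OF V \<rho>])
  have scal: "h (t *\<^sub>R 1) = (\<lambda>x. t *\<^sub>R x)" for t
    using \<rho> by (simp add: h_def clifford_module_def clifford_scalar_def)
  have vec: "h (letter v) = module_map V g \<rho> v" for v
    by (simp add: h_def module_map_def clifford_vector_def)
  have word: "h (Poly_Mapping.single (Word w) t) = (\<lambda>x. t *\<^sub>R foldr (module_map V g \<rho>) w x)"
    if "w \<in> lists V" for w t
    using that
  proof induction
    case Nil
    have "Poly_Mapping.single (Word []) t = t *\<^sub>R (1 :: 'a free_monoid \<Rightarrow>\<^sub>0 real)"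
      by (rule poly_mapping_eqI) (auto simp: lookup_scaleR_real lookup_single lookup_one
          zero_free_monoid_def when_def)
    then show ?case by (simp add: scal)
  next
    case (Cons v w)
    have "Poly_Mapping.single (Word (v # w)) t = letter v * Poly_Mapping.single (Word w) t"
      by (simp add: letter_def mult_single)
    moreover have "h (letter v * Poly_Mapping.single (Word w) t) =
        h (letter v) \<circ> h (Poly_Mapping.single (Word w) t)"
      using ring_hom_mult[OF hom, of "letter v" "Poly_Mapping.single (Word w) t"] Cons
      by (auto simp: letter_def)
    moreover have "linear (h (letter v))"
      using ring_hom_closed[OF hom, of "letter v"] Cons by (auto simp: letter_def)
    ultimately show ?case using Cons by (auto simp: vec linear_scale o_def)
  qed
  have sum: "h (sum f K) = (\<lambda>x. \<Sum>k\<in>K. h (f k) x)"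
    if "finite K" "\<And>k. k \<in> K \<Longrightarrow> Poly_Mapping.keys (f k) \<subseteq> Word ` lists V" for f :: "'a free_monoid \<Rightarrow> _" and K
    using that
  proof induction
    case empty
    then show ?case
      using ring_hom_zero[OF hom free_algebra_ring End_ring_ring] by simp
  next
    case (insert k K)
    have "Poly_Mapping.keys (sum f K) \<subseteq> Word ` lists V"
      using Poly_Mapping.keys_sum[of f K] insert by blast
    then have "h (f k + sum f K) = (\<lambda>x. h (f k) x + h (sum f K) x)"
      using ring_hom_add[OF hom, of "f k" "sum f K"] insert by auto
    then show ?case using insert by simp
  qed
  have "h p = h (\<Sum>k\<in>Poly_Mapping.keys p. Poly_Mapping.single k (Poly_Mapping.lookup p k))"
    by (subst poly_mapping_sum_single[of p]) simp
  also have "\<dots> = (\<lambda>x. \<Sum>k\<in>Poly_Mapping.keys p. h (Poly_Mapping.single k (Poly_Mapping.lookup p k)) x)"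
    by (rule sum) (use p in \<open>auto split: if_splits\<close>)
  also have "\<dots> = free_action (module_map V g \<rho>) p"
    unfolding free_action_def[abs_def]
    by (intro ext sum.cong refl, erule word_keyE[OF _ p]) (simp add: word)
  finally show ?thesis by (simp add: h_def)
qed

lemma letter_in_free_algebra: "v \<in> V \<Longrightarrow> Poly_Mapping.keys (letter v) \<subseteq> Word ` lists V"
  by (auto simp: letter_def)

lemma clifford_vector_in_algebra:
  "v \<in> V \<Longrightarrow> clifford_vector V g v \<in> carrier (clifford_algebra V g)"
  using letter_in_free_algebra[of v V] by (auto simp: carrier_clifford_algebra clifford_vector_def)

lemma linear_module_map:
  assumes "clifford_module V g \<rho>" "v \<in> V"
  shows "linear (module_map V g \<rho> v)"
  using assms clifford_vector_in_algebra[of v V g]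
  by (auto simp: clifford_module_def module_map_def dest: ring_hom_closed)

lemma clifford_condition_module_map:
  assumes V: "subspace V" and \<rho>: "clifford_module V g \<rho>"
  shows "clifford_condition V g (module_map V g \<rho>)"
proof -
  let ?c = "module_map V g \<rho>"
  let ?I = "clifford_ideal V g"
  have lin: "\<And>v. v \<in> V \<Longrightarrow> linear (?c v)" by (rule linear_module_map[OF \<rho>])
  interpret I: ideal ?I "free_algebra V" by (rule clifford_ideal_ideal[OF V])
  have zero: "free_action ?c p x = 0" if "p \<in> clifford_relations V g" for p x
  proof -
    have p: "p \<in> ?I" by (rule clifford_relation_in_ideal[OF V that])
    have "?I +>\<^bsub>free_algebra V\<^esub> p = ?I +>\<^bsub>free_algebra V\<^esub> 0"
      using I.a_rcos_const[OF p] I.a_rcos_const[OF additive_subgroup.zero_closed[OF ideal.axioms(1)[OF I.ideal_axioms]]] by simp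
    moreover have "Poly_Mapping.keys p \<subseteq> Word ` lists V"
      using p I.a_subset by auto
    ultimately have "free_action ?c p = free_action ?c 0"
      using clifford_module_eq_free_action[OF V \<rho>, of p]
        clifford_module_eq_free_action[OF V \<rho>, of 0] by simp
    then show ?thesis by simp
  qed
  show ?thesis
    unfolding clifford_condition_def
  proof (intro conjI ballI allI)
    fix v w x t assume v: "v \<in> V"
    show "linear (?c v)" by (rule lin[OF v])
    have "letter (t *\<^sub>R v) - t *\<^sub>R letter v \<in> clifford_relations V g"
      using v unfolding clifford_relations_def by blast
    from zero[OF this, of x] show "?c (t *\<^sub>R v) x = t *\<^sub>R ?c v x"
      by (simp add: free_action_diff free_action_scale)
    assume w: "w \<in> V"
    have "letter (v + w) - (letter v + letter w) \<in> clifford_relations V g"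
      using v w unfolding clifford_relations_def by blast
    from zero[OF this, of x] show "?c (v + w) x = ?c v x + ?c w x"
      by (simp add: free_action_diff free_action_add)
    have "letter v * letter w + letter w * letter v + (2 * g v w) *\<^sub>R 1 \<in> clifford_relations V g"
      using v w unfolding clifford_relations_def by blast
    from zero[OF this, of x]
    have "?c v (?c w x) + ?c w (?c v x) + (2 * g v w) *\<^sub>R x = 0"
      by (simp add: free_action_add free_action_scale free_action_mult[where V = V and c = ?c, OF lin letter_in_free_algebra] v w)
    then show "?c v (?c w x) + ?c w (?c v x) = (- 2 * g v w) *\<^sub>R x"
      by (simp add: add_eq_0_iff2)
  qed
qed

lemma clifford_conditionD:
  assumes "clifford_condition V g c"
  shows "v \<in> V \<Longrightarrow> linear (c v)"
    "v \<in> V \<Longrightarrow> w \<in> V \<Longrightarrow> c (v + w) x = c v x + c w x"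
    "v \<in> V \<Longrightarrow> c (t *\<^sub>R v) x = t *\<^sub>R c v x"
    "v \<in> V \<Longrightarrow> w \<in> V \<Longrightarrow> c v (c w x) + c w (c v x) = (- 2 * g v w) *\<^sub>R x"
  by (fact assms[unfolded clifford_condition_def, THEN conjunct1, rule_format]
      assms[unfolded clifford_condition_def, THEN conjunct2, THEN conjunct1, rule_format]
      assms[unfolded clifford_condition_def, THEN conjunct2, THEN conjunct2, THEN conjunct1, rule_format]
      assms[unfolded clifford_condition_def, THEN conjunct2, THEN conjunct2, THEN conjunct2, rule_format])+

text \<open>
  The universal property: the kernel of the action of the free algebra is an ideal, and the
  Clifford condition says that it contains the defining relations.
\<close>

lemma clifford_module_exists:
  assumes V: "subspace V" and c: "clifford_condition V g c"
  shows "\<exists>\<rho>. has_clifford_map V g \<rho> c"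
proof -
  let ?I = "clifford_ideal V g"
  note lin = clifford_conditionD(1)[OF c]
  interpret I: ideal ?I "free_algebra V" by (rule clifford_ideal_ideal[OF V])
  interpret h: ring_hom_ring "free_algebra V" End_ring "free_action c"
    by (rule ring_hom_ringI2[OF free_algebra_ring End_ring_ring free_action_hom[where V = V and c = c, OF lin]])
  have "?I \<subseteq> a_kernel (free_algebra V) End_ring (free_action c)"
    unfolding clifford_ideal_def
  proof (rule I.genideal_minimal[OF h.kernel_is_ideal], rule subsetI)
    fix p assume p: "p \<in> clifford_relations V g"
    have car: "p \<in> carrier (free_algebra V)"
      by (rule subsetD[OF clifford_relations_subset[OF V] p])
    consider v w where "v \<in> V" "w \<in> V" "p = letter (v + w) - (letter v + letter w)"
      | t v where "v \<in> V" "p = letter (t *\<^sub>R v) - t *\<^sub>R letter v"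
      | v w where "v \<in> V" "w \<in> V" "p = letter v * letter w + letter w * letter v + (2 * g v w) *\<^sub>R 1"
      using p unfolding clifford_relations_def by blast
    then have "free_action c p x = 0" for x
    proof cases
      case 1
      then show ?thesis by (simp add: clifford_conditionD(2)[OF c] free_action_diff free_action_add)
    next
      case 2
      then show ?thesis by (simp add: clifford_conditionD(3)[OF c] free_action_diff free_action_scale)
    next
      case 3
      have rel: "c v (c w x) + c w (c v x) = (- 2 * g v w) *\<^sub>R x"
        by (rule clifford_conditionD(4)[OF c 3(1,2)])
      have mul: "free_action c (letter a * q) x = c a (free_action c q x)" if "a \<in> V" for a q
        using free_action_mult[where V = V and c = c, OF lin letter_in_free_algebra[OF that]] by simp
      have "free_action c p x = c v (c w x) + c w (c v x) + (2 * g v w) *\<^sub>R x"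
        by (simp only: 3(3) free_action_add free_action_scale mul[OF 3(1)] mul[OF 3(2)]
            free_action_letter free_action_one)
      then show ?thesis unfolding rel by (simp flip: scaleR_add_left)
    qed
    then show "p \<in> a_kernel (free_algebra V) End_ring (free_action c)"
      using car by (simp only: a_kernel_def' End_ring_simps fun_eq_iff mem_Collect_eq simp_thms)
  qed
  then have ker: "free_action c p = (\<lambda>x. 0)" if "p \<in> ?I" for p
    using that unfolding a_kernel_def' End_ring_simps by blast
  \<comment> \<open>Any representative of a coset may be used, because the ideal acts by zero.\<close>
  define \<rho> where "\<rho> X = free_action c (SOME p. p \<in> X)" for X :: "'a clifford"
  have \<rho>: "\<rho> (?I +>\<^bsub>free_algebra V\<^esub> p) = free_action c p" if p: "p \<in> carrier (free_algebra V)" for p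
  proof -
    have "p \<in> ?I +>\<^bsub>free_algebra V\<^esub> p" by (rule I.a_rcos_self[OF p])
    then have "(SOME q. q \<in> ?I +>\<^bsub>free_algebra V\<^esub> p) \<in> ?I +>\<^bsub>free_algebra V\<^esub> p" by (rule someI)
    then obtain k where "k \<in> ?I" "(SOME q. q \<in> ?I +>\<^bsub>free_algebra V\<^esub> p) = k + p"
      by (auto simp: a_r_coset_def')
    then show ?thesis using ker[of k] by (auto simp: \<rho>_def free_action_add fun_eq_iff)
  qed
  have hom: "\<rho> \<in> ring_hom (clifford_algebra V g) End_ring"
  proof (rule ring_hom_memI)
    have one: "\<one>\<^bsub>clifford_algebra V g\<^esub> = ?I +>\<^bsub>free_algebra V\<^esub> 1"
      by (simp add: clifford_algebra_def FactRing_def)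
    show "\<rho> \<one>\<^bsub>clifford_algebra V g\<^esub> = \<one>\<^bsub>End_ring\<^esub>"
      using \<rho>[of 1] I.one_closed by (simp add: one fun_eq_iff)
    fix X assume X: "X \<in> carrier (clifford_algebra V g)"
    then obtain p where p: "p \<in> carrier (free_algebra V)" "X = ?I +>\<^bsub>free_algebra V\<^esub> p"
      unfolding carrier_clifford_algebra by blast
    show "\<rho> X \<in> carrier End_ring" using h.hom_closed[OF p(1)] by (simp only: p(2) \<rho>[OF p(1)])
    fix Y assume "Y \<in> carrier (clifford_algebra V g)"
    then obtain q where q: "q \<in> carrier (free_algebra V)" "Y = ?I +>\<^bsub>free_algebra V\<^esub> q"
      unfolding carrier_clifford_algebra by blast
    have "X \<otimes>\<^bsub>clifford_algebra V g\<^esub> Y = ?I +>\<^bsub>free_algebra V\<^esub> (p \<otimes>\<^bsub>free_algebra V\<^esub> q)"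
      using I.rcoset_mult_add[OF p(1) q(1)] p(2) q(2) by (simp add: clifford_algebra_def FactRing_def)
    then show "\<rho> (X \<otimes>\<^bsub>clifford_algebra V g\<^esub> Y) = \<rho> X \<otimes>\<^bsub>End_ring\<^esub> \<rho> Y"
      using \<rho>[OF I.m_closed[OF p(1) q(1)]] h.hom_mult[OF p(1) q(1)]
      by (simp only: p(2) q(2) \<rho>[OF p(1)] \<rho>[OF q(1)])
    have "X \<oplus>\<^bsub>clifford_algebra V g\<^esub> Y = ?I +>\<^bsub>free_algebra V\<^esub> (p \<oplus>\<^bsub>free_algebra V\<^esub> q)"
      using I.a_rcos_sum[OF p(1) q(1)] p(2) q(2) by (simp add: clifford_algebra_def FactRing_def)
    then show "\<rho> (X \<oplus>\<^bsub>clifford_algebra V g\<^esub> Y) = \<rho> X \<oplus>\<^bsub>End_ring\<^esub> \<rho> Y"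
      using \<rho>[OF I.a_closed[OF p(1) q(1)]] h.hom_add[OF p(1) q(1)]
      by (simp only: p(2) q(2) \<rho>[OF p(1)] \<rho>[OF q(1)])
  qed
  have "\<rho> (clifford_scalar V g t) = (\<lambda>x. t *\<^sub>R x)" for t
  proof -
    have "Poly_Mapping.keys (t *\<^sub>R (1 :: 'a free_monoid \<Rightarrow>\<^sub>0 real)) \<subseteq> {0}"
      by (auto simp: in_keys_iff lookup_scaleR_real lookup_one)
    then have "t *\<^sub>R 1 \<in> carrier (free_algebra V)" by (auto simp: zero_free_monoid_def)
    then show ?thesis using \<rho>[of "t *\<^sub>R 1"] by (simp add: clifford_scalar_def free_action_scale fun_eq_iff)
  qed
  moreover have "\<rho> (clifford_vector V g v) = c v" if "v \<in> V" for v
    using \<rho>[of "letter v"] letter_in_free_algebra[OF that]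
    by (simp add: clifford_vector_def fun_eq_iff)
  ultimately have "has_clifford_map V g \<rho> c"
    using hom by (simp add: has_clifford_map_def clifford_module_def module_map_def)
  then show ?thesis by blast
qed

definition invariant_subspace ::
    "'v set \<Rightarrow> ('v \<Rightarrow> 'a \<Rightarrow> 'a::real_vector) \<Rightarrow> 'a set \<Rightarrow> bool" where
  "invariant_subspace V c U \<longleftrightarrow> subspace U \<and> (\<forall>v\<in>V. \<forall>x\<in>U. c v x \<in> U)"

definition irreducible_map :: "'v set \<Rightarrow> ('v \<Rightarrow> 'a \<Rightarrow> 'a::real_vector) \<Rightarrow> bool" where
  "irreducible_map V c \<longleftrightarrow> (\<exists>x::'a. x \<noteq> 0) \<and>
     (\<forall>U. invariant_subspace V c U \<longrightarrow> U = {0} \<or> U = UNIV)"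

definition intertwiner ::
    "'v set \<Rightarrow> ('v \<Rightarrow> 'a \<Rightarrow> 'a::real_vector) \<Rightarrow> ('v \<Rightarrow> 'b \<Rightarrow> 'b::real_vector) \<Rightarrow> ('a \<Rightarrow> 'b) \<Rightarrow> bool" where
  "intertwiner V c d f \<longleftrightarrow> linear f \<and> (\<forall>v\<in>V. \<forall>x. f (c v x) = d v (f x))"

lemma invariant_foldr:
  assumes "invariant_subspace V c U" "w \<in> lists V" "x \<in> U"
  shows "foldr c w x \<in> U"
  using assms(2) by induction (use assms(1,3) in \<open>auto simp: invariant_subspace_def\<close>)

lemma intertwiner_foldr:
  assumes "intertwiner V c d f" "w \<in> lists V"
  shows "f (foldr c w x) = foldr d w (f x)"
  using assms(2) by induction (use assms(1) in \<open>auto simp: intertwiner_def\<close>)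

lemma irreducible_clifford_module_iff:
  assumes V: "subspace V" and \<rho>: "clifford_module V g \<rho>"
  shows "irreducible_clifford_module V g \<rho> \<longleftrightarrow> irreducible_map V (module_map V g \<rho>)"
proof -
  have "(\<forall>A\<in>carrier (clifford_algebra V g). \<rho> A ` U \<subseteq> U) \<longleftrightarrow>
      (\<forall>v\<in>V. \<forall>x\<in>U. module_map V g \<rho> v x \<in> U)" if U: "subspace U" for U
  proof
    assume "\<forall>A\<in>carrier (clifford_algebra V g). \<rho> A ` U \<subseteq> U"
    then show "\<forall>v\<in>V. \<forall>x\<in>U. module_map V g \<rho> v x \<in> U"
      unfolding module_map_def using clifford_vector_in_algebra by blast
  next
    assume "\<forall>v\<in>V. \<forall>x\<in>U. module_map V g \<rho> v x \<in> U"
    then have inv: "invariant_subspace V (module_map V g \<rho>) U"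
      using U by (simp add: invariant_subspace_def)
    show "\<forall>A\<in>carrier (clifford_algebra V g). \<rho> A ` U \<subseteq> U"
    proof (intro ballI subsetI, elim imageE)
      fix A y x assume A: "A \<in> carrier (clifford_algebra V g)" and x: "y = \<rho> A x" "x \<in> U"
      obtain p where p: "Poly_Mapping.keys p \<subseteq> Word ` lists V" "A = clifford_ideal V g +>\<^bsub>free_algebra V\<^esub> p"
        using A unfolding carrier_clifford_algebra by auto
      have "free_action (module_map V g \<rho>) p x \<in> U"
        unfolding free_action_def
        by (intro subspace_sum subspace_scale U, erule word_keyE[OF _ p(1)])
          (simp add: invariant_foldr[OF inv _ x(2)])
      then show "y \<in> U" using clifford_module_eq_free_action[OF V \<rho> p(1)] p(2) x by simp
    qed
  qed
  note inv = this
  have nz: "(UNIV :: 'b set) \<noteq> {0} \<longleftrightarrow> (\<exists>x::'b. x \<noteq> 0)" by auto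
  show ?thesis
    unfolding irreducible_clifford_module_def irreducible_map_def invariant_subspace_def nz
    using \<rho> inv by blast
qed

lemma isomorphic_clifford_modules_iff:
  assumes V: "subspace V" and \<rho>: "clifford_module V g \<rho>" and \<sigma>: "clifford_module V g \<sigma>"
  shows "isomorphic_clifford_modules V g \<rho> \<sigma> \<longleftrightarrow>
    (\<exists>f. bij f \<and> intertwiner V (module_map V g \<rho>) (module_map V g \<sigma>) f)"
proof -
  have "(\<forall>A\<in>carrier (clifford_algebra V g). \<forall>x. f (\<rho> A x) = \<sigma> A (f x)) \<longleftrightarrow>
      (\<forall>v\<in>V. \<forall>x. f (module_map V g \<rho> v x) = module_map V g \<sigma> v (f x))" if f: "linear f" for f
  proof
    assume "\<forall>A\<in>carrier (clifford_algebra V g). \<forall>x. f (\<rho> A x) = \<sigma> A (f x)"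
    then show "\<forall>v\<in>V. \<forall>x. f (module_map V g \<rho> v x) = module_map V g \<sigma> v (f x)"
      unfolding module_map_def using clifford_vector_in_algebra by blast
  next
    assume "\<forall>v\<in>V. \<forall>x. f (module_map V g \<rho> v x) = module_map V g \<sigma> v (f x)"
    then have tw: "intertwiner V (module_map V g \<rho>) (module_map V g \<sigma>) f"
      using f by (simp add: intertwiner_def)
    show "\<forall>A\<in>carrier (clifford_algebra V g). \<forall>x. f (\<rho> A x) = \<sigma> A (f x)"
    proof (intro ballI allI)
      fix A x assume A: "A \<in> carrier (clifford_algebra V g)"
      obtain p where p: "Poly_Mapping.keys p \<subseteq> Word ` lists V" "A = clifford_ideal V g +>\<^bsub>free_algebra V\<^esub> p"
        using A unfolding carrier_clifford_algebra by auto
      have "f (free_action (module_map V g \<rho>) p x) = free_action (module_map V g \<sigma>) p (f x)"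
        unfolding free_action_def linear_sum[OF f] linear_scale[OF f]
        by (intro sum.cong refl, erule word_keyE[OF _ p(1)]) (simp add: intertwiner_foldr[OF tw])
      then show "f (\<rho> A x) = \<sigma> A (f x)"
        using clifford_module_eq_free_action[OF V \<rho> p(1)] clifford_module_eq_free_action[OF V \<sigma> p(1)]
          p(2) by simp
    qed
  qed
  then show ?thesis unfolding isomorphic_clifford_modules_def intertwiner_def by blast
qed

section \<open>Schur's lemma and separating functionals\<close>

lemma irreducible_map_UNIV:
  assumes "irreducible_map V c" "invariant_subspace V c U" "x \<in> U" "x \<noteq> 0"
  shows "U = UNIV"
  using assms unfolding irreducible_map_def by blast

lemma irreducible_map_nonzero:
  fixes c :: "'v \<Rightarrow> 'a \<Rightarrow> 'a::real_vector"
  assumes "irreducible_map V c"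
  obtains x :: 'a where "x \<noteq> 0"
  using assms unfolding irreducible_map_def by blast

text \<open>
  The kernel and the range of an intertwiner are invariant.
\<close>

lemma schur:
  assumes c: "irreducible_map V c" and d: "irreducible_map V d"
    and lin: "\<And>v. v \<in> V \<Longrightarrow> linear (d v)"
    and f: "intertwiner V c d f" and nz: "f x \<noteq> 0"
  shows "bij f"
proof -
  have lf: "linear f" and tw: "\<And>v x. v \<in> V \<Longrightarrow> f (c v x) = d v (f x)"
    using f by (auto simp: intertwiner_def)
  have "invariant_subspace V c {x. f x = 0}"
    using lin by (auto simp: invariant_subspace_def tw linear_0 linear_subspace_kernel[OF lf])
  moreover have "{x. f x = 0} \<noteq> UNIV" using nz by auto
  ultimately have "{x. f x = 0} = {0}" using c unfolding irreducible_map_def by blast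
  then have "inj f" using linear_injective_0[OF lf] by auto
  moreover have "invariant_subspace V d (range f)"
    using tw by (auto simp: invariant_subspace_def linear_subspace_image[OF lf] simp flip: tw)
  then have "range f = UNIV" using irreducible_map_UNIV[OF d, of "range f" "f x"] nz by blast
  ultimately show ?thesis by (simp add: bij_def)
qed

lemma separating_functional:
  fixes x y :: "'a::real_vector"
  assumes "x \<noteq> 0" "\<And>a. y \<noteq> a *\<^sub>R x"
  obtains l :: "'a \<Rightarrow> real" where "linear l" "l x = 1" "l y = 0"
proof -
  have "y \<notin> span {x}" using assms(2) by (auto simp: span_singleton)
  then have "independent {y, x}" using assms(1) by (simp add: independent_insert)
  from linear_independent_extend[OF this, of "\<lambda>z. if z = x then 1 else 0"]
  obtain l :: "'a \<Rightarrow> real" where "linear l" "l x = 1" "l y = (if y = x then 1 else 0)" by auto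
  moreover have "y \<noteq> x" using assms(2)[of 1] by simp
  ultimately show ?thesis using that by simp
qed

lemma nonzero_functional:
  fixes x :: "'a::real_vector"
  assumes "x \<noteq> 0"
  obtains l :: "'a \<Rightarrow> real" where "linear l" "l x = 1"
proof -
  have "independent {x}" using assms by simp
  from linear_independent_extend[OF this, of "\<lambda>z. 1"] show ?thesis using that by auto
qed

section \<open>Anticommuting operators\<close>

definition anticommuting :: "nat \<Rightarrow> (nat \<Rightarrow> real) \<Rightarrow> (nat \<Rightarrow> 'a \<Rightarrow> 'a::real_vector) \<Rightarrow> bool" where
  "anticommuting n e E \<longleftrightarrow> (\<forall>j<n. linear (E j) \<and> e j * e j = 1 \<and> (\<forall>x. E j (E j x) = e j *\<^sub>R x)) \<and>
     (\<forall>j<n. \<forall>k<n. j \<noteq> k \<longrightarrow> (\<forall>x. E j (E k x) = - E k (E j x)))"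

lemma anticommutingD:
  assumes "anticommuting n e E"
  shows "j < n \<Longrightarrow> linear (E j)" "j < n \<Longrightarrow> e j * e j = 1"
    "j < n \<Longrightarrow> E j (E j x) = e j *\<^sub>R x"
    "j < n \<Longrightarrow> k < n \<Longrightarrow> j \<noteq> k \<Longrightarrow> E j (E k x) = - E k (E j x)"
proof -
  note sq = assms[unfolded anticommuting_def, THEN conjunct1, rule_format]
  show "j < n \<Longrightarrow> linear (E j)" by (rule sq[THEN conjunct1])
  show "j < n \<Longrightarrow> e j * e j = 1" by (rule sq[THEN conjunct2, THEN conjunct1])
  show "j < n \<Longrightarrow> E j (E j x) = e j *\<^sub>R x"
    by (rule sq[THEN conjunct2, THEN conjunct2, rule_format])
  show "j < n \<Longrightarrow> k < n \<Longrightarrow> j \<noteq> k \<Longrightarrow> E j (E k x) = - E k (E j x)"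
    by (rule assms[unfolded anticommuting_def, THEN conjunct2, rule_format])
qed

lemma anticommuting_mono: "anticommuting n e E \<Longrightarrow> m \<le> n \<Longrightarrow> anticommuting m e E"
  unfolding anticommuting_def by (meson less_le_trans)

text \<open>
  The product of the first \<open>n\<close> operators. In a Clifford module it is the action of the volume
  element of the first \<open>n\<close> basis vectors.
\<close>

fun vol :: "(nat \<Rightarrow> 'a \<Rightarrow> 'a) \<Rightarrow> nat \<Rightarrow> 'a \<Rightarrow> 'a" where
  "vol E 0 x = x"
| "vol E (Suc n) x = vol E n (E n x)"

lemma linear_vol:
  assumes "\<And>j. j < n \<Longrightarrow> linear (E j)"
  shows "linear (vol E n)"
  using assms
proof (induction n)
  case 0
  show ?case using linear_id by (simp add: id_def)
next
  case (Suc n)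
  have "linear (vol E n \<circ> E n)" using Suc by (intro linear_compose) auto
  then show ?case by (simp add: o_def)
qed

lemma vol_intertwine:
  assumes "\<And>j x. j < n \<Longrightarrow> f (E j x) = F j (f x)"
  shows "f (vol E n x) = vol F n (f x)"
  using assms by (induction n arbitrary: x) auto

text \<open>
  Moving \<open>E j\<close> through the product costs one sign for every factor other than \<open>E j\<close> itself. Hence
  the product of an even number of operators anticommutes with each of its factors, and that of
  an odd number commutes with them.
\<close>

lemma vol_commute:
  assumes E: "anticommuting n e E" and "m \<le> n" "j < n"
  shows "vol E m (E j x) = (-1) ^ (if j < m then Suc m else m) *\<^sub>R E j (vol E m x)"
  using assms(2)
proof (induction m arbitrary: x)
  case 0
  then show ?case by simp
next
  case (Suc m)
  note IH = Suc.IH[OF Suc_leD[OF Suc.prems]]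
  have lin: "linear (vol E m)"
    using anticommutingD(1)[OF E] Suc.prems by (intro linear_vol) auto
  show ?case
  proof (cases "j = m")
    case True
    then show ?thesis using IH[of "E m x"] by simp
  next
    case False
    have "E m (E j x) = - E j (E m x)" using Suc.prems assms(3) False by (intro anticommutingD(4)[OF E]) auto
    then show ?thesis using False IH[of "E m x"] by (simp add: linear_neg[OF lin] less_Suc_eq)
  qed
qed

lemma vol_square:
  assumes E: "anticommuting n e E" and "m \<le> n"
  shows "vol E m (vol E m x) = (\<Prod>j<m. (-1) ^ j * e j) *\<^sub>R x"
  using assms(2)
proof (induction m arbitrary: x)
  case 0
  then show ?case by simp
next
  case (Suc m)
  have m: "m \<le> n" "m < n" using Suc.prems by auto
  have lin: "linear (vol E m)" "linear (E m)"
    using anticommutingD(1)[OF E] m by (auto intro!: linear_vol)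
  have "vol E m (E m (vol E m (E m x))) = (-1) ^ m *\<^sub>R vol E m (vol E m (E m (E m x)))"
    using vol_commute[OF E m, of "E m x"]
    by (simp add: linear_scale[OF lin(1)] flip: power_mult_distrib)
  then show ?case
    using Suc.IH[OF m(1)] anticommutingD(3)[OF E m(2)] by (simp add: ac_simps linear_scale[OF lin(1)])
qed

lemma vol_sign_square:
  assumes "anticommuting n e E" "m \<le> n"
  shows "(\<Prod>j<m. (-1) ^ j * e j) * (\<Prod>j<m. (-1) ^ j * e j) = (1::real)"
proof -
  have "((-1) ^ j * e j) * ((-1) ^ j * e j) = 1" if "j < m" for j
    using anticommutingD(2)[OF assms(1), of j] that assms(2)
    by (simp add: algebra_simps flip: power_add mult_2)
  then show ?thesis by (simp flip: prod.distrib)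
qed

lemma vol_inj:
  assumes E: "anticommuting n e E" and m: "m \<le> n" and eq: "vol E m x = vol E m y"
  shows "x = y"
proof -
  let ?s = "\<Prod>j<m. (-1) ^ j * e j"
  have "?s *\<^sub>R x = ?s *\<^sub>R y" using eq vol_square[OF E m] by metis
  then show ?thesis using vol_sign_square[OF E m] by (metis mult_zero_left scaleR_cancel_left zero_neq_one)
qed

text \<open>
  The linear maps \<open>\<phi>\<close> between the two spaces carry the commuting involutions
  \<open>\<phi> \<mapsto> F j \<circ> \<phi> \<circ> (E j)\<inverse>\<close>, and an intertwiner is a common fixed point. Each
  involution can be brought to eigenvalue \<open>1\<close> separately without losing the fixed points already
  reached: symmetrize \<open>\<phi>\<close>, or, if this gives \<open>0\<close>, compose \<open>\<phi>\<close> with \<open>vol F n \<circ> F m\<close>, which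
  commutes with all \<open>F j\<close> except that it anticommutes with \<open>F m\<close>. The latter needs \<open>n\<close> even.
  The operators \<open>W\<close> and \<open>W'\<close> are an extra constraint that survives the process; they will be the
  identity or the volume element of an odd-dimensional space.
\<close>

lemma exists_intertwiner:
  fixes E :: "nat \<Rightarrow> 'a \<Rightarrow> 'a::real_vector" and F :: "nat \<Rightarrow> 'b \<Rightarrow> 'b::real_vector"
  assumes E: "anticommuting n e E" and F: "anticommuting n e F" and n: "even n"
    and \<phi>: "linear \<phi>" "\<phi> x0 \<noteq> 0" "\<And>x. \<phi> (W x) = W' (\<phi> x)"
    and W: "\<And>j x. j < n \<Longrightarrow> W (E j x) = E j (W x)"
    and W': "linear W'" "\<And>j y. j < n \<Longrightarrow> W' (F j y) = F j (W' y)"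
  shows "\<exists>\<psi>. linear \<psi> \<and> (\<exists>x. \<psi> x \<noteq> 0) \<and> (\<forall>j<n. \<forall>x. \<psi> (E j x) = F j (\<psi> x)) \<and>
    (\<forall>x. \<psi> (W x) = W' (\<psi> x))"
proof -
  have "m \<le> n \<Longrightarrow> \<exists>\<psi>. linear \<psi> \<and> (\<exists>x. \<psi> x \<noteq> 0) \<and> (\<forall>j<m. \<forall>x. \<psi> (E j x) = F j (\<psi> x)) \<and>
    (\<forall>x. \<psi> (W x) = W' (\<psi> x))" for m
  proof (induction m)
    case 0
    show ?case using \<phi> by auto
  next
    case (Suc m)
    then obtain \<psi> x1 where \<psi>: "linear \<psi>" "\<psi> x1 \<noteq> 0" "\<And>j x. j < m \<Longrightarrow> \<psi> (E j x) = F j (\<psi> x)"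
        "\<And>x. \<psi> (W x) = W' (\<psi> x)" by auto
    have m: "m < n" using Suc.prems by simp
    note lE = anticommutingD(1)[OF E m] and lF = anticommutingD(1)[OF F m]
    note e2 = anticommutingD(2)[OF E m]
    note EE = anticommutingD(3)[OF E m] and FF = anticommutingD(3)[OF F m]
    define \<psi>1 where "\<psi>1 x = \<psi> x + e m *\<^sub>R F m (\<psi> (E m x))" for x
    show ?case
    proof (cases "\<exists>x. \<psi>1 x \<noteq> 0")
      case True
      have "linear \<psi>1"
        by (rule linearI) (simp_all add: \<psi>1_def linear_add[OF lE] linear_add[OF lF] linear_add[OF \<psi>(1)]
            linear_scale[OF lE] linear_scale[OF lF] linear_scale[OF \<psi>(1)] algebra_simps)
      moreover have "\<psi>1 (E j x) = F j (\<psi>1 x)" if "j < Suc m" for j x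
      proof (cases "j = m")
        case True
        then show ?thesis
          by (simp add: \<psi>1_def EE FF linear_add[OF lF] linear_scale[OF lF] linear_scale[OF \<psi>(1)] e2)
      next
        case False
        then have j: "j < m" "j < n" "m \<noteq> j" using that m by auto
        note lj = anticommutingD(1)[OF F j(2)]
        have "F m (\<psi> (E m (E j x))) = F j (F m (\<psi> (E m x)))"
          using anticommutingD(4)[OF E m j(2,3)] anticommutingD(4)[OF F m j(2,3)]
          by (simp add: linear_neg[OF \<psi>(1)] linear_neg[OF lF] \<psi>(3)[OF j(1)])
        then show ?thesis
          by (simp add: \<psi>1_def linear_add[OF lj] linear_scale[OF lj] \<psi>(3)[OF j(1)])
      qed
      moreover have "\<psi>1 (W x) = W' (\<psi>1 x)" for x
        using W[OF m, of x] by (simp add: \<psi>1_def linear_add[OF W'(1)] linear_scale[OF W'(1)] W'(2)[OF m] \<psi>(4)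
            flip: W[OF m])
      ultimately show ?thesis using True by blast
    next
      case False
      then have "\<psi> x = - (e m *\<^sub>R F m (\<psi> (E m x)))" for x
        by (simp add: \<psi>1_def eq_neg_iff_add_eq_0)
      then have "e m *\<^sub>R \<psi> x = - (e m *\<^sub>R e m *\<^sub>R F m (\<psi> (E m x)))" for x
        by (metis scaleR_minus_right)
      then have neg: "F m (\<psi> (E m x)) = - (e m *\<^sub>R \<psi> x)" for x
        by (simp add: e2)
      \<comment> \<open>The symmetrization vanishes, so the involution acts by \<open>-1\<close>; the flip changes this sign.\<close>
      let ?G = "vol F n"
      have lG: "linear ?G" by (rule linear_vol) (rule anticommutingD(1)[OF F])
      have anti: "?G (F j y) = - F j (?G y)" if "j < n" for j y
        using vol_commute[OF F order_refl that, of y] that n by simp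
      have "linear (\<lambda>x. ?G (F m (\<psi> x)))"
        by (rule linearI) (simp_all add: linear_add[OF lG] linear_add[OF lF] linear_add[OF \<psi>(1)]
            linear_scale[OF lG] linear_scale[OF lF] linear_scale[OF \<psi>(1)])
      moreover have "?G (F m (\<psi> x1)) \<noteq> 0"
      proof
        assume "?G (F m (\<psi> x1)) = 0"
        then have "F m (\<psi> x1) = 0"
          using vol_inj[OF F order_refl, of "F m (\<psi> x1)" 0] by (simp add: linear_0[OF lG])
        then have "e m *\<^sub>R \<psi> x1 = 0" by (simp add: linear_0[OF lF] flip: FF)
        then show False using e2 \<psi>(2) by auto
      qed
      moreover have "?G (F m (\<psi> (E j x))) = F j (?G (F m (\<psi> x)))" if "j < Suc m" for j x
      proof (cases "j = m")
        case True
        then show ?thesis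
          using anti[OF m, of "F m (\<psi> x)"] by (simp add: neg FF linear_neg[OF lG] equation_minus_iff)
      next
        case False
        then have j: "j < m" "j < n" "m \<noteq> j" using that m by auto
        show ?thesis
          using anticommutingD(4)[OF F m j(2,3), of "\<psi> x"] anti[OF j(2)]
          by (simp add: \<psi>(3)[OF j(1)] linear_neg[OF lG])
      qed
      moreover have "?G (F m (\<psi> (W x))) = W' (?G (F m (\<psi> x)))" for x
        by (simp add: \<psi>(4) vol_intertwine[where f = W' and E = F and F = F, OF W'(2)] flip: W'(2)[OF m])
      ultimately show ?thesis by blast
    qed
  qed
  from this[of n] show ?thesis by simp
qed

section \<open>Classification by the volume element\<close>

abbreviation basis_op :: "((nat \<Rightarrow>\<^sub>0 real) \<Rightarrow> 'a \<Rightarrow> 'a) \<Rightarrow> nat \<Rightarrow> 'a \<Rightarrow> 'a" where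
  "basis_op c j \<equiv> c (Poly_Mapping.single j 1)"

abbreviation basis_sign :: "nat \<Rightarrow> nat \<Rightarrow> real" where
  "basis_sign r j \<equiv> (if j < r then 1 else -1)"

lemma single_in_Rn: "j < n \<Longrightarrow> Poly_Mapping.single j t \<in> Rn n"
  by (auto simp: Rn_def lookup_single when_def)

lemma gform_single:
  assumes "j < r + s" "k < r + s"
  shows "gform r s (Poly_Mapping.single j 1) (Poly_Mapping.single k 1) =
    (if j = k then - basis_sign r j else 0)"
proof -
  have "(\<Sum>l<s. Poly_Mapping.lookup (Poly_Mapping.single j 1) (r + l) *
      Poly_Mapping.lookup (Poly_Mapping.single k (1::real)) (r + l)) =
      (\<Sum>l<s. if l = j - r then (if j = k \<and> r \<le> j then 1 else 0) else 0)"
    by (rule sum.cong) (auto simp: lookup_single when_def)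
  moreover have "(\<Sum>l<r. Poly_Mapping.lookup (Poly_Mapping.single j 1) l *
      Poly_Mapping.lookup (Poly_Mapping.single k (1::real)) l) =
      (\<Sum>l<r. if l = j then (if j = k then 1 else 0) else 0)"
    by (rule sum.cong) (auto simp: lookup_single when_def)
  ultimately show ?thesis using assms by (auto simp: gform_def)
qed

lemma clifford_condition_anticommuting:
  assumes c: "clifford_condition (Rn (r + s)) (gform r s) c"
  shows "anticommuting (r + s) (basis_sign r) (basis_op c)"
proof -
  note mem = single_in_Rn[of _ "r + s" 1]
  have lin: "linear (basis_op c j)" if "j < r + s" for j
    by (rule clifford_conditionD(1)[OF c mem[OF that]])
  have sq: "basis_op c j (basis_op c j x) = basis_sign r j *\<^sub>R x" if "j < r + s" for j x
  proof -
    have g: "gform r s (Poly_Mapping.single j 1) (Poly_Mapping.single j 1) = - basis_sign r j"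
      using gform_single[OF that that] by simp
    have "2 *\<^sub>R basis_op c j (basis_op c j x) = (- 2 * - basis_sign r j) *\<^sub>R x"
      unfolding scaleR_2 clifford_conditionD(4)[OF c mem[OF that] mem[OF that], of x] g ..
    then have "2 *\<^sub>R basis_op c j (basis_op c j x) = 2 *\<^sub>R (basis_sign r j *\<^sub>R x)"
      by (simp only: scaleR_scaleR minus_mult_minus)
    then show ?thesis by (simp only: scaleR_cancel_left) simp
  qed
  have anti: "basis_op c j (basis_op c k x) = - basis_op c k (basis_op c j x)"
    if "j < r + s" "k < r + s" "j \<noteq> k" for j k x
  proof -
    have g: "gform r s (Poly_Mapping.single j 1) (Poly_Mapping.single k 1) = 0"
      using gform_single[OF that(1,2)] that(3) by simp
    show ?thesis
      using clifford_conditionD(4)[OF c mem[OF that(1)] mem[OF that(2)], of x]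
      unfolding g eq_neg_iff_add_eq_0 by simp
  qed
  show ?thesis unfolding anticommuting_def
  proof (intro conjI allI impI)
    show "basis_sign r j * basis_sign r j = 1" for j by simp
  qed (fact lin sq anti)+
qed

lemma clifford_map_sum:
  assumes c: "clifford_condition (Rn n) g c" and v: "v \<in> Rn n"
  shows "c v x = (\<Sum>j<n. Poly_Mapping.lookup v j *\<^sub>R basis_op c j x)"
proof -
  have zero: "c 0 x = 0"
    using clifford_conditionD(3)[OF c subspace_0[OF subspace_Rn], of 0 x] by simp
  have part: "c (\<Sum>j<m. Poly_Mapping.lookup v j *\<^sub>R Poly_Mapping.single j 1) x =
      (\<Sum>j<m. Poly_Mapping.lookup v j *\<^sub>R basis_op c j x)" if "m \<le> n" for m
    using that
  proof (induction m)
    case 0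
    show ?case by (simp add: zero)
  next
    case (Suc m)
    have "(\<Sum>j<m. Poly_Mapping.lookup v j *\<^sub>R Poly_Mapping.single j 1) \<in> Rn n"
      using Suc.prems by (intro subspace_sum subspace_scale subspace_Rn single_in_Rn) auto
    moreover have "Poly_Mapping.single m 1 \<in> Rn n" using Suc.prems by (intro single_in_Rn) auto
    ultimately show ?case
      using Suc by (simp add: clifford_conditionD(2,3)[OF c] subspace_scale[OF subspace_Rn])
  qed
  have "v = (\<Sum>j<n. Poly_Mapping.lookup v j *\<^sub>R Poly_Mapping.single j 1)"
  proof (rule poly_mapping_eqI)
    fix k
    have "(\<Sum>j<n. Poly_Mapping.lookup v j * Poly_Mapping.lookup (Poly_Mapping.single j (1::real)) k) =
        (\<Sum>j<n. if j = k then Poly_Mapping.lookup v k else 0)"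
      by (rule sum.cong) (auto simp: lookup_single when_def)
    then show "Poly_Mapping.lookup v k =
        Poly_Mapping.lookup (\<Sum>j<n. Poly_Mapping.lookup v j *\<^sub>R Poly_Mapping.single j 1) k"
      using v by (auto simp: lookup_sum lookup_scaleR_real Rn_def)
  qed
  then show ?thesis using part[of n] by simp
qed

lemma intertwiner_basis:
  assumes c: "clifford_condition (Rn n) g c" and d: "clifford_condition (Rn n) g' d"
    and f: "linear f" "\<And>j x. j < n \<Longrightarrow> f (basis_op c j x) = basis_op d j (f x)"
  shows "intertwiner (Rn n) c d f"
  unfolding intertwiner_def
  using f by (auto simp: clifford_map_sum[OF c] clifford_map_sum[OF d] linear_sum[OF f(1)] linear_scale[OF f(1)])

definition volume_element :: "nat \<Rightarrow> nat \<Rightarrow> ((nat \<Rightarrow>\<^sub>0 real) \<Rightarrow> 'a \<Rightarrow> 'a) \<Rightarrow> 'a \<Rightarrow> 'a" where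
  "volume_element r s c = vol (basis_op c) (r + s)"

text \<open>
  The signatures for which the volume element is central and has square \<open>1\<close>; it then acts on an
  irreducible module by a sign, its chirality, which separates the two isomorphism classes.
\<close>

definition chiral :: "nat \<Rightarrow> nat \<Rightarrow> bool" where
  "chiral r s \<longleftrightarrow> (int r - int s) mod 4 = 1"

lemma volume_sign:
  "(\<Prod>j<r + s. (-1) ^ j * basis_sign r j) =
    (if (r + s) mod 4 < 2 then 1 else -1) * (-1::real) ^ s"
proof -
  have a: "(\<Prod>j<n. (-1::real) ^ j) = (if n mod 4 < 2 then 1 else -1)" for n
  proof (induction n)
    case (Suc n)
    have "n mod 4 = 0 \<or> n mod 4 = 1 \<or> n mod 4 = 2 \<or> n mod 4 = 3" by presburger
    moreover have "even n \<longleftrightarrow> n mod 4 = 0 \<or> n mod 4 = 2" by presburger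
    ultimately show ?case using Suc by (auto simp: mod_Suc)
  qed simp
  have b: "(\<Prod>j<r + t. basis_sign r j) = (-1) ^ t" for t
    by (induction t) auto
  show ?thesis unfolding prod.distrib a b ..
qed

lemma chiral_iff:
  "chiral r s \<longleftrightarrow> odd (r + s) \<and> (\<Prod>j<r + s. (-1) ^ j * basis_sign r j) = (1::real)"
proof -
  have "chiral r s \<longleftrightarrow> odd (r + s) \<and> ((r + s) mod 4 < 2 \<longleftrightarrow> even s)"
    unfolding chiral_def by presburger
  then show ?thesis unfolding volume_sign by (cases "even s") auto
qed

lemma nonchiral_sign:
  assumes "\<not> chiral r s" "odd (r + s)"
  shows "(\<Prod>j<r + s. (-1) ^ j * basis_sign r j) = (-1::real)"
  using assms unfolding chiral_iff volume_sign
  by (cases "even s"; cases "(r + s) mod 4 < 2") auto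

lemma volume_commute:
  assumes c: "clifford_condition (Rn (r + s)) (gform r s) c" and "odd (r + s)" "j < r + s"
  shows "volume_element r s c (basis_op c j x) = basis_op c j (volume_element r s c x)"
  using vol_commute[OF clifford_condition_anticommuting[OF c] order_refl assms(3), of x] assms(2,3)
  by (simp add: volume_element_def)

lemma linear_volume:
  assumes c: "clifford_condition (Rn (r + s)) (gform r s) c"
  shows "linear (volume_element r s c)"
  unfolding volume_element_def
  by (rule linear_vol) (rule anticommutingD(1)[OF clifford_condition_anticommuting[OF c]])

lemma volume_square:
  assumes c: "clifford_condition (Rn (r + s)) (gform r s) c"
  shows "volume_element r s c (volume_element r s c x) = (\<Prod>j<r + s. (-1) ^ j * basis_sign r j) *\<^sub>R x"
  unfolding volume_element_def by (rule vol_square[OF clifford_condition_anticommuting[OF c] order_refl])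

text \<open>
  In odd dimension the first \<open>r + s - 1\<close> basis vectors are even in number, and the last one is,
  up to sign, the product of the others with the volume element. So it suffices to commute with
  the former and with the volume element.
\<close>

lemma odd_intertwiner:
  assumes c: "clifford_condition (Rn (r + s)) (gform r s) c"
    and d: "clifford_condition (Rn (r + s)) (gform r s) d" and odd: "odd (r + s)"
    and \<phi>: "linear \<phi>" "\<phi> x0 \<noteq> 0" "\<And>x. \<phi> (volume_element r s c x) = volume_element r s d (\<phi> x)"
  shows "\<exists>\<psi>. intertwiner (Rn (r + s)) c d \<psi> \<and> (\<exists>x. \<psi> x \<noteq> 0)"
proof -
  obtain m where m: "r + s = Suc m" "even m" using odd by (metis even_Suc not0_implies_Suc odd_pos not_gr_zero)
  note Ac = clifford_condition_anticommuting[OF c] and Ad = clifford_condition_anticommuting[OF d]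
  have mle: "m \<le> r + s" using m by simp
  obtain \<psi> x1 where \<psi>: "linear \<psi>" "\<psi> x1 \<noteq> 0"
    "\<And>j x. j < m \<Longrightarrow> \<psi> (basis_op c j x) = basis_op d j (\<psi> x)"
    "\<And>x. \<psi> (volume_element r s c x) = volume_element r s d (\<psi> x)"
  proof -
    have "\<exists>\<psi>. linear \<psi> \<and> (\<exists>x. \<psi> x \<noteq> 0) \<and>
        (\<forall>j<m. \<forall>x. \<psi> (basis_op c j x) = basis_op d j (\<psi> x)) \<and>
        (\<forall>x. \<psi> (volume_element r s c x) = volume_element r s d (\<psi> x))"
      by (rule exists_intertwiner[where \<phi> = \<phi> and ?x0.0 = x0,
            OF anticommuting_mono[OF Ac mle] anticommuting_mono[OF Ad mle] m(2) \<phi>(1,2)])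
        (use mle in \<open>simp_all add: \<phi>(3) volume_commute[OF c odd] linear_volume[OF d] volume_commute[OF d odd]\<close>)
    then show thesis using that by blast
  qed
  have "\<psi> (basis_op c m x) = basis_op d m (\<psi> x)" for x
  proof (rule vol_inj[OF Ad mle])
    have "vol (basis_op d) m (\<psi> (basis_op c m x)) = \<psi> (volume_element r s c x)"
      using vol_intertwine[where f = \<psi> and E = "basis_op c" and F = "basis_op d" and n = m, OF \<psi>(3)]
      by (simp add: volume_element_def m(1))
    then show "vol (basis_op d) m (\<psi> (basis_op c m x)) = vol (basis_op d) m (basis_op d m (\<psi> x))"
      using \<psi>(4)[of x] by (simp add: volume_element_def m(1))
  qed
  then have "\<psi> (basis_op c j x) = basis_op d j (\<psi> x)" if "j < r + s" for j x
    using \<psi>(3) that m(1) by (auto simp: less_Suc_eq)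
  then show ?thesis using intertwiner_basis[OF c d \<psi>(1)] \<psi>(2) by blast
qed

text \<open>
  Some nonzero linear map, compatible with the volume elements in odd dimension, always exists,
  and then there is an intertwiner. For odd dimension and square \<open>-1\<close> the volume elements are
  complex structures, and the map is made from a rank-one map by passing to its complex-linear part.
\<close>

lemma nonchiral_isomorphic:
  fixes c :: "(nat \<Rightarrow>\<^sub>0 real) \<Rightarrow> 'a \<Rightarrow> 'a::real_vector" and d :: "(nat \<Rightarrow>\<^sub>0 real) \<Rightarrow> 'b \<Rightarrow> 'b::real_vector"
  assumes c: "clifford_condition (Rn (r + s)) (gform r s) c" "irreducible_map (Rn (r + s)) c"
    and d: "clifford_condition (Rn (r + s)) (gform r s) d" "irreducible_map (Rn (r + s)) d"
    and nc: "\<not> chiral r s"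
  shows "\<exists>f. bij f \<and> intertwiner (Rn (r + s)) c d f"
proof -
  obtain x0 where x0: "x0 \<noteq> (0::'a)" by (rule irreducible_map_nonzero[OF c(2)])
  obtain t where t: "t \<noteq> (0::'b)" by (rule irreducible_map_nonzero[OF d(2)])
  have "\<exists>\<psi>. intertwiner (Rn (r + s)) c d \<psi> \<and> (\<exists>x. \<psi> x \<noteq> 0)"
  proof (cases "even (r + s)")
    case True
    obtain l where l: "linear l" "l x0 = (1::real)" using nonzero_functional[OF x0] .
    have lin: "linear (\<lambda>x. l x *\<^sub>R t)"
      by (rule linearI) (simp_all add: linear_add[OF l(1)] linear_scale[OF l(1)] scaleR_add_left)
    have nz: "l x0 *\<^sub>R t \<noteq> 0" using l t by simp
    have "\<exists>\<psi>. linear \<psi> \<and> (\<exists>x. \<psi> x \<noteq> 0) \<and>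
        (\<forall>j<r + s. \<forall>x. \<psi> (basis_op c j x) = basis_op d j (\<psi> x)) \<and>
        (\<forall>x. \<psi> (id x) = id (\<psi> x))"
      by (rule exists_intertwiner[where \<phi> = "\<lambda>x. l x *\<^sub>R t" and ?x0.0 = x0,
            OF clifford_condition_anticommuting[OF c(1)]
            clifford_condition_anticommuting[OF d(1)] True lin nz])
        (simp_all add: linear_id[unfolded id_def])
    then show ?thesis using intertwiner_basis[OF c(1) d(1)] by blast
  next
    case False
    have W2: "volume_element r s c (volume_element r s c x) = - x" for x
      using volume_square[OF c(1)] nonchiral_sign[OF nc False] by simp
    have W'2: "volume_element r s d (volume_element r s d x) = - x" for x
      using volume_square[OF d(1)] nonchiral_sign[OF nc False] by simp
    note lW = linear_volume[OF c(1)] and lW' = linear_volume[OF d(1)]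
    have "volume_element r s c x0 \<noteq> a *\<^sub>R x0" for a
    proof
      assume a: "volume_element r s c x0 = a *\<^sub>R x0"
      have "- x0 = (a * a) *\<^sub>R x0" using W2[of x0] by (simp add: a linear_scale[OF lW])
      then have "(a * a + 1) *\<^sub>R x0 = 0" by (simp add: scaleR_add_left flip: \<open>- x0 = _\<close>)
      then show False using x0 zero_le_square[of a] by simp
    qed
    then obtain l where l: "linear l" "l x0 = (1::real)" "l (volume_element r s c x0) = 0"
      using separating_functional[OF x0] by blast
    define \<phi> where "\<phi> y = l y *\<^sub>R t - l (volume_element r s c y) *\<^sub>R volume_element r s d t" for y
    have "linear \<phi>"
      by (rule linearI) (simp_all add: \<phi>_def linear_add[OF l(1)] linear_scale[OF l(1)]
          linear_add[OF lW] linear_scale[OF lW] algebra_simps)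
    moreover have "\<phi> x0 \<noteq> 0" using l t by (simp add: \<phi>_def)
    moreover have "\<phi> (volume_element r s c x) = volume_element r s d (\<phi> x)" for x
      by (simp add: \<phi>_def W2 W'2 linear_neg[OF l(1)] linear_diff[OF lW'] linear_scale[OF lW'])
    ultimately show ?thesis by (rule odd_intertwiner[OF c(1) d(1) False])
  qed
  then show ?thesis using schur[OF c(2) d(2) clifford_conditionD(1)[OF d(1)]] by blast
qed

text \<open>
  When both volume elements are the same scalar, compatibility with them is automatic.
\<close>

lemma chiral_isomorphic:
  fixes c :: "(nat \<Rightarrow>\<^sub>0 real) \<Rightarrow> 'a \<Rightarrow> 'a::real_vector" and d :: "(nat \<Rightarrow>\<^sub>0 real) \<Rightarrow> 'b \<Rightarrow> 'b::real_vector"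
  assumes c: "clifford_condition (Rn (r + s)) (gform r s) c" "irreducible_map (Rn (r + s)) c"
    and d: "clifford_condition (Rn (r + s)) (gform r s) d" "irreducible_map (Rn (r + s)) d"
    and odd: "odd (r + s)"
    and w: "\<And>x. volume_element r s c x = w *\<^sub>R x" "\<And>y. volume_element r s d y = w *\<^sub>R y"
  shows "\<exists>f. bij f \<and> intertwiner (Rn (r + s)) c d f"
proof -
  obtain x0 where x0: "x0 \<noteq> (0::'a)" by (rule irreducible_map_nonzero[OF c(2)])
  obtain t where t: "t \<noteq> (0::'b)" by (rule irreducible_map_nonzero[OF d(2)])
  obtain l where l: "linear l" "l x0 = (1::real)" using nonzero_functional[OF x0] .
  have "linear (\<lambda>x. l x *\<^sub>R t)"
    by (rule linearI) (simp_all add: linear_add[OF l(1)] linear_scale[OF l(1)] scaleR_add_left)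
  moreover have "l x0 *\<^sub>R t \<noteq> 0" using l t by simp
  ultimately have "\<exists>\<psi>. intertwiner (Rn (r + s)) c d \<psi> \<and> (\<exists>x. \<psi> x \<noteq> 0)"
    by (rule odd_intertwiner[OF c(1) d(1) odd]) (simp add: w linear_scale[OF l(1)])
  then show ?thesis using schur[OF c(2) d(2) clifford_conditionD(1)[OF d(1)]] by blast
qed

text \<open>
  The volume element is a central involution, so its fixed space is a submodule.
\<close>

lemma chiral_volume:
  assumes c: "clifford_condition (Rn (r + s)) (gform r s) c" "irreducible_map (Rn (r + s)) c"
    and ch: "chiral r s"
  shows "(\<forall>x. volume_element r s c x = 1 *\<^sub>R x) \<or> (\<forall>x. volume_element r s c x = (-1) *\<^sub>R x)"
proof -
  let ?W = "volume_element r s c"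
  have odd: "odd (r + s)" and W2: "?W (?W x) = x" for x
    using ch volume_square[OF c(1), of x] by (auto simp: chiral_iff)
  note lW = linear_volume[OF c(1)]
  have comm: "?W (c v x) = c v (?W x)" if "v \<in> Rn (r + s)" for v x
    using intertwiner_basis[OF c(1) c(1) lW volume_commute[OF c(1) odd]] that
    by (auto simp: intertwiner_def)
  have "invariant_subspace (Rn (r + s)) c {x. ?W x = x}"
    by (auto simp: invariant_subspace_def subspace_def comm linear_0[OF lW] linear_add[OF lW] linear_scale[OF lW])
  then consider "{x. ?W x = x} = UNIV" | "{x. ?W x = x} = {0}"
    using c(2) unfolding irreducible_map_def by blast
  then show ?thesis
  proof cases
    case 1
    then show ?thesis by auto
  next
    case 2
    have "?W (x + ?W x) = x + ?W x" for x by (simp add: linear_add[OF lW] W2 add.commute)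
    then have "x + ?W x = 0" for x using 2 by blast
    then show ?thesis by (simp add: eq_neg_iff_add_eq_0 add.commute)
  qed
qed

lemma intertwiner_volume:
  assumes "intertwiner (Rn (r + s)) c d f"
  shows "f (volume_element r s c x) = volume_element r s d (f x)"
  unfolding volume_element_def
  by (rule vol_intertwine) (use assms single_in_Rn in \<open>auto simp: intertwiner_def\<close>)

lemma opposite_clifford_condition:
  assumes c: "clifford_condition V g c"
  shows "clifford_condition V g (\<lambda>v x. - c v x)"
  using clifford_conditionD[OF c]
  by (auto simp: clifford_condition_def linear_compose_neg linear_neg)

lemma opposite_irreducible:
  assumes "irreducible_map V c"
  shows "irreducible_map V (\<lambda>v x. - c v x)"
proof -
  have "invariant_subspace V (\<lambda>v x. - c v x) U \<longleftrightarrow> invariant_subspace V c U" for U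
    unfolding invariant_subspace_def using subspace_neg by (metis minus_minus)
  then show ?thesis using assms by (simp add: irreducible_map_def)
qed

lemma opposite_volume:
  assumes c: "clifford_condition (Rn (r + s)) (gform r s) c"
  shows "volume_element r s (\<lambda>v x. - c v x) x = (-1) ^ (r + s) *\<^sub>R volume_element r s c x"
proof -
  have "vol (\<lambda>j x. - basis_op c j x) m x = (-1) ^ m *\<^sub>R vol (basis_op c) m x" if "m \<le> r + s" for m x
    using that
  proof (induction m arbitrary: x)
    case (Suc m)
    have "linear (vol (basis_op c) m)"
      using Suc.prems anticommutingD(1)[OF clifford_condition_anticommuting[OF c]]
      by (intro linear_vol) auto
    then show ?case using Suc by (simp add: linear_neg)
  qed simp
  then show ?thesis by (simp add: volume_element_def)
qed

text \<open>
  Changing the sign of the Clifford map changes the sign of an odd product, hence the chirality.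
\<close>

lemma chiral_opposite_not_isomorphic:
  fixes c :: "(nat \<Rightarrow>\<^sub>0 real) \<Rightarrow> 'a \<Rightarrow> 'a::real_vector"
  assumes c: "clifford_condition (Rn (r + s)) (gform r s) c" "irreducible_map (Rn (r + s)) c"
    and ch: "chiral r s"
  shows "\<not> (\<exists>f. bij f \<and> intertwiner (Rn (r + s)) c (\<lambda>v x. - c v x) f)"
proof
  assume "\<exists>f. bij f \<and> intertwiner (Rn (r + s)) c (\<lambda>v x. - c v x) f"
  then obtain f where f: "bij f" "intertwiner (Rn (r + s)) c (\<lambda>v x. - c v x) f" by blast
  have lf: "linear f" using f(2) by (simp add: intertwiner_def)
  obtain w where w: "w = 1 \<or> w = (-1::real)" "\<And>x. volume_element r s c x = w *\<^sub>R x"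
    using chiral_volume[OF c ch] by metis
  obtain x where x: "x \<noteq> (0::'a)" by (rule irreducible_map_nonzero[OF c(2)])
  have odd: "odd (r + s)" using ch by (simp add: chiral_iff)
  have "(-1::real) ^ (r + s) = -1" using odd by simp
  then have "w *\<^sub>R f x = - (w *\<^sub>R f x)"
    using intertwiner_volume[OF f(2), of x]
    by (simp only: opposite_volume[OF c(1)] w(2) linear_scale[OF lf] scaleR_minus1_left)
  then have "f x = - f x" using w(1) by auto
  then have "2 *\<^sub>R f x = 0" by (simp only: scaleR_2 eq_neg_iff_add_eq_0)
  then have "f x = 0" by simp
  then show False using x f(1) linear_0[OF lf] by (metis bij_is_inj injD)
qed

section \<open>Hyperbolic pairs\<close>

text \<open>
  In signature \<open>(i, i)\<close> the basis vectors \<open>k\<close> and \<open>i + k\<close> have squares \<open>1\<close> and \<open>-1\<close>, so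
  that \<open>E k \<circ> E (i + k)\<close> is an involution. It commutes with every vector orthogonal to its two
  factors, in particular with the other involutions of this kind.
\<close>

lemma hyperbolic_pairD:
  assumes E: "anticommuting (i + i) (basis_sign i) E" and k: "k < i"
  shows "linear (E k)" "linear (E (i + k))" "E k (E k x) = x" "E (i + k) (E (i + k) x) = - x"
    "E (i + k) (E k x) = - E k (E (i + k) x)"
  using anticommutingD(1,3)[OF E, of k] anticommutingD(1,3)[OF E, of "i + k"]
    anticommutingD(4)[OF E, of "i + k" k] k by simp_all

lemma hyperbolic_commute:
  assumes E: "anticommuting (i + i) (basis_sign i) E" and "k < i" "j < i + i" "j \<noteq> k" "j \<noteq> i + k"
  shows "E k (E (i + k) (E j x)) = E j (E k (E (i + k) x))"
proof -
  have "E (i + k) (E j x) = - E j (E (i + k) x)" "E k (E j y) = - E j (E k y)" for y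
    using assms by (auto intro!: anticommutingD(4)[OF E])
  then show ?thesis using linear_neg[OF hyperbolic_pairD(1)[OF E assms(2)]] by simp
qed

lemma hyperbolic_flip:
  assumes E: "anticommuting (i + i) (basis_sign i) E" and "k < i"
  shows "E k (E (i + k) (E k x)) = - E k (E k (E (i + k) x))"
  by (simp add: hyperbolic_pairD(5)[OF assms] linear_neg[OF hyperbolic_pairD(1)[OF assms]])

text \<open>
  The same alternative as for intertwiners: symmetrize, or flip the eigenvalue \<open>-1\<close> with \<open>E m\<close>,
  which anticommutes with the \<open>m\<close>-th involution only.
\<close>

lemma exists_fixed_vector:
  assumes E: "anticommuting (i + i) (basis_sign i) E"
    and U: "subspace U" "\<And>j t. j < i + i \<Longrightarrow> t \<in> U \<Longrightarrow> E j t \<in> U" and t: "t \<in> U" "t \<noteq> 0"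
  shows "\<exists>t\<in>U. t \<noteq> 0 \<and> (\<forall>k<i. E k (E (i + k) t) = t)"
proof -
  have "m \<le> i \<Longrightarrow> \<exists>t\<in>U. t \<noteq> 0 \<and> (\<forall>k<m. E k (E (i + k) t) = t)" for m
  proof (induction m)
    case 0
    then show ?case using t by auto
  next
    case (Suc m)
    then obtain a where a: "a \<in> U" "a \<noteq> 0" "\<And>k. k < m \<Longrightarrow> E k (E (i + k) a) = a" by auto
    have m: "m < i" using Suc.prems by simp
    let ?P = "\<lambda>x. E m (E (i + m) x)"
    note pair = hyperbolic_pairD[OF E m]
    have PP: "?P (?P x) = x" for x
      by (simp add: pair(3,4,5) linear_neg[OF pair(1)])
    have com: "E k (E (i + k) (?P a)) = ?P a" if "k < m" for k
    proof -
      have "E k (E (i + k) (E m (E (i + m) a))) = E m (E k (E (i + k) (E (i + m) a)))"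
        using that m by (intro hyperbolic_commute[OF E]) auto
      also have "E k (E (i + k) (E (i + m) a)) = E (i + m) (E k (E (i + k) a))"
        using that m by (intro hyperbolic_commute[OF E]) auto
      finally show ?thesis by (simp add: a(3)[OF that])
    qed
    show ?case
    proof (cases "a + ?P a = 0")
      case False
      have "a + ?P a \<in> U" using a(1) m by (intro subspace_add U) auto
      moreover have "?P (a + ?P a) = a + ?P a"
        by (simp add: linear_add[OF pair(1)] linear_add[OF pair(2)] PP add.commute)
      moreover have "E k (E (i + k) (a + ?P a)) = a + ?P a" if "k < m" for k
      proof -
        have k: "k < i" using that m by simp
        show ?thesis
          by (simp only: linear_add[OF hyperbolic_pairD(1)[OF E k]]
              linear_add[OF hyperbolic_pairD(2)[OF E k]] com[OF that] a(3)[OF that])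
      qed
      ultimately show ?thesis using False by (metis less_Suc_eq)
    next
      case True
      then have neg: "?P a = - a" by (simp add: eq_neg_iff_add_eq_0 add.commute)
      have "E m a \<in> U" using a(1) m by (intro U) auto
      moreover have "E m a \<noteq> 0"
        using a(2) pair(3)[of a] linear_0[OF pair(1)] by metis
      moreover have "?P (E m a) = E m a"
        by (simp add: hyperbolic_flip[OF E m] neg linear_neg[OF pair(1)])
      moreover have "E k (E (i + k) (E m a)) = E m a" if "k < m" for k
      proof -
        have "E k (E (i + k) (E m a)) = E m (E k (E (i + k) a))"
          using that m by (intro hyperbolic_commute[OF E]) auto
        then show ?thesis by (simp add: a(3)[OF that])
      qed
      ultimately show ?thesis by (metis less_Suc_eq)
    qed
  qed
  from this[of i] show ?thesis by simp
qed

text \<open>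
  The subspace generated by \<open>R0\<close> contains no fixed vectors beyond those of \<open>R0\<close>. On fixed
  vectors \<open>E (i + m)\<close> agrees with \<open>E m\<close>, so closing up under the \<open>m\<close>-th pair only requires adding
  the image under \<open>E m\<close>, on which the \<open>m\<close>-th involution is \<open>-1\<close>.
\<close>

lemma exists_hyperbolic_extension:
  assumes E: "anticommuting (i + i) (basis_sign i) E"
    and R0: "subspace R0" "\<And>k t. k < i \<Longrightarrow> t \<in> R0 \<Longrightarrow> E k (E (i + k) t) = t"
  shows "\<exists>R. subspace R \<and> R0 \<subseteq> R \<and> (\<forall>j<i + i. \<forall>t\<in>R. E j t \<in> R) \<and>
    (\<forall>t\<in>R. (\<forall>k<i. E k (E (i + k) t) = t) \<longrightarrow> t \<in> R0)"
proof -
  have "m \<le> i \<Longrightarrow> \<exists>R. subspace R \<and> R0 \<subseteq> R \<and> (\<forall>k<m. \<forall>t\<in>R. E k t \<in> R \<and> E (i + k) t \<in> R) \<and>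
      (\<forall>k<i. m \<le> k \<longrightarrow> (\<forall>t\<in>R. E k (E (i + k) t) = t)) \<and>
      (\<forall>t\<in>R. (\<forall>k<m. E k (E (i + k) t) = t) \<longrightarrow> t \<in> R0)" for m
  proof (induction m)
    case 0
    then show ?case using R0 by (intro exI[of _ R0]) auto
  next
    case (Suc m)
    then obtain R where R: "subspace R" "R0 \<subseteq> R"
      "\<And>k t. k < m \<Longrightarrow> t \<in> R \<Longrightarrow> E k t \<in> R" "\<And>k t. k < m \<Longrightarrow> t \<in> R \<Longrightarrow> E (i + k) t \<in> R"
      "\<And>k t. k < i \<Longrightarrow> m \<le> k \<Longrightarrow> t \<in> R \<Longrightarrow> E k (E (i + k) t) = t"
      "\<And>t. t \<in> R \<Longrightarrow> (\<And>k. k < m \<Longrightarrow> E k (E (i + k) t) = t) \<Longrightarrow> t \<in> R0"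
      by (auto 0 3)
    have m: "m < i" using Suc.prems by simp
    note pair = hyperbolic_pairD[OF E m]
    have fe: "E (i + m) a = E m a" if "a \<in> R" for a
      using R(5)[OF m order_refl that] pair(3)[of "E (i + m) a"] by simp
    define R' where "R' = {a + E m b | a b. a \<in> R \<and> b \<in> R}"
    have R'I: "a + E m b \<in> R'" if "a \<in> R" "b \<in> R" for a b using that by (auto simp: R'_def)
    have sub: "subspace R'"
      unfolding subspace_def
    proof (intro conjI ballI allI)
      show "0 \<in> R'" using R'I[OF subspace_0 subspace_0, OF R(1) R(1)] by (simp add: linear_0[OF pair(1)])
      fix x assume "x \<in> R'"
      then obtain a b where x: "x = a + E m b" "a \<in> R" "b \<in> R" by (auto simp: R'_def)
      show "t *\<^sub>R x \<in> R'" for t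
        using R'I[OF subspace_scale[OF R(1) x(2)] subspace_scale[OF R(1) x(3)], of t t]
        by (simp add: x(1) scaleR_add_right linear_scale[OF pair(1)])
      fix y assume "y \<in> R'"
      then obtain a' b' where y: "y = a' + E m b'" "a' \<in> R" "b' \<in> R" by (auto simp: R'_def)
      show "x + y \<in> R'"
        using R'I[OF subspace_add[OF R(1) x(2) y(2)] subspace_add[OF R(1) x(3) y(3)]]
        by (simp add: x(1) y(1) linear_add[OF pair(1)] ac_simps)
    qed
    have "R \<subseteq> R'" using R'I[OF _ subspace_0[OF R(1)]] by (auto simp: linear_0[OF pair(1)])
    moreover have "E k t \<in> R' \<and> E (i + k) t \<in> R'" if k: "k < Suc m" and t: "t \<in> R'" for k t
    proof -
      obtain a b where t: "t = a + E m b" "a \<in> R" "b \<in> R" using t by (auto simp: R'_def)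
      show ?thesis
      proof (cases "k = m")
        case True
        have "E m t = b + E m a" by (simp add: t(1) linear_add[OF pair(1)] pair(3))
        moreover have "E (i + m) t = - b + E m a"
          by (simp add: t(1) linear_add[OF pair(2)] pair(3,5) fe[OF t(2)] fe[OF t(3)])
        ultimately show ?thesis
          using True R'I[OF t(3) t(2)] R'I[OF subspace_neg[OF R(1) t(3)] t(2)] by simp
      next
        case False
        then have k: "k < m" using k by simp
        have *: "E j t = E j a + E m (- E j b)" if "j = k \<or> j = i + k" for j
        proof -
          have j: "j < i + i" "j \<noteq> m" using that k m by auto
          show ?thesis
            using anticommutingD(4)[OF E j(1), of m b] m j
            by (simp add: t(1) linear_add[OF anticommutingD(1)[OF E j(1)]] linear_neg[OF pair(1)])
        qed
        show ?thesis
          unfolding *[OF disjI1[OF refl]] *[OF disjI2[OF refl]]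
          using R(3,4)[OF k] t(2,3) by (intro conjI R'I subspace_neg[OF R(1)])
      qed
    qed
    moreover have "E k (E (i + k) t) = t" if k: "k < i" "Suc m \<le> k" and t: "t \<in> R'" for k t
    proof -
      obtain a b where t: "t = a + E m b" "a \<in> R" "b \<in> R" using t by (auto simp: R'_def)
      have "E k (E (i + k) (E m b)) = E m (E k (E (i + k) b))"
        using k m by (intro hyperbolic_commute[OF E]) auto
      then show ?thesis
        using R(5)[OF k(1) _ t(2)] R(5)[OF k(1) _ t(3)] k(2)
        by (simp add: t(1) linear_add[OF hyperbolic_pairD(1)[OF E k(1)]]
            linear_add[OF hyperbolic_pairD(2)[OF E k(1)]])
    qed
    \<comment> \<open>The \<open>m\<close>-th involution maps \<open>a + E m b\<close> to \<open>a - E m b\<close>.\<close>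
    moreover have "t \<in> R0" if t: "t \<in> R'" and fixed: "\<And>k. k < Suc m \<Longrightarrow> E k (E (i + k) t) = t" for t
    proof -
      obtain a b where t: "t = a + E m b" "a \<in> R" "b \<in> R" using t by (auto simp: R'_def)
      have "E m (E (i + m) t) = a - E m b"
        using R(5)[OF m order_refl t(2)] R(5)[OF m order_refl t(3)]
        by (simp add: t(1) linear_add[OF pair(1)] linear_add[OF pair(2)] hyperbolic_flip[OF E m])
      then have "a - E m b = a + E m b" using fixed[of m] t(1) by simp
      then have "E m b + E m b = 0" by (simp add: algebra_simps)
      then have "2 *\<^sub>R E m b = 0" by (simp only: scaleR_2)
      then have "t = a" using t(1) by simp
      then show ?thesis using R(6)[OF t(2)] fixed by simp
    qed
    ultimately show ?case using sub R(2) by (intro exI[of _ R']) (auto 0 3)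
  qed
  from this[of i] obtain R where R: "subspace R" "R0 \<subseteq> R"
      "\<And>k t. k < i \<Longrightarrow> t \<in> R \<Longrightarrow> E k t \<in> R \<and> E (i + k) t \<in> R"
      "\<And>t. t \<in> R \<Longrightarrow> (\<forall>k<i. E k (E (i + k) t) = t) \<Longrightarrow> t \<in> R0" by (auto 0 3)
  have "E j t \<in> R" if "j < i + i" "t \<in> R" for j t
    using R(3)[of j t] R(3)[of "j - i" t] that by (cases "j < i") auto
  then show ?thesis using R(1,2,4) by blast
qed

section \<open>Operators on tensor products\<close>

lemma tens_zero [simp]: "tens 0 y = 0" "tens x 0 = 0"
  using tens_scale_left[of 0 0 y] tens_scale_right[of x 0 0] by simp_all

lemma tens_minus: "tens (- x) y = - tens x y" "tens x (- y) = - tens x y"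
  using tens_scale_left[of "-1" x y] tens_scale_right[of x "-1" y] by simp_all

lemma tens_eq_0_iff:
  fixes x :: "'a::real_vector" and y :: "'b::real_vector"
  shows "tens x y = 0 \<longleftrightarrow> x = 0 \<or> y = 0"
proof -
  have False if x: "x \<noteq> 0" and y: "y \<noteq> 0" and 0: "tens x y = 0"
  proof -
    obtain l where l: "linear l" "l x = (1::real)" using nonzero_functional[OF x] .
    obtain F :: "('a, 'b) tensor \<Rightarrow> 'b" where "linear F" "\<And>x y. F (tens x y) = l x *\<^sub>R y"
      by (rule tensor_universal[of "\<lambda>x y. l x *\<^sub>R y"])
        (auto intro!: linearI simp: linear_add[OF l(1)] linear_scale[OF l(1)] algebra_simps)
    then have "y = F 0" using l(2) 0 by (metis scaleR_one)
    then show False using y linear_0[OF \<open>linear F\<close>] by simp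
  qed
  then show ?thesis by auto
qed

lemma tens_left_cancel: "x \<noteq> 0 \<Longrightarrow> tens x y = tens x y' \<longleftrightarrow> y = y'"
  using tens_eq_0_iff[of x "y - y'"] tens_add_right[of x y "- y'"] by (auto simp: tens_minus)

lemma linear_tens: "linear (tens x)" "linear (\<lambda>x. tens x y)"
  by (auto intro!: linearI simp: tens_add_right tens_scale_right tens_add_left tens_scale_left)

lemma subspace_containing_tens:
  assumes U: "subspace U" and "\<And>x y. tens x y \<in> U"
  shows "U = UNIV"
proof -
  have "span (range (\<lambda>(x, y). tens x y)) \<subseteq> U"
    using assms by (intro span_minimal) auto
  then show ?thesis by (auto simp: span_tens)
qed

text \<open>
  Identities between graded operators need only be checked on homogeneous left factors, where
  the sign is known.
\<close>

lemma tensor_linear_unique_graded: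
  fixes F H :: "('a::real_vector, 'b::real_vector) tensor \<Rightarrow> 'c::real_vector"
  assumes gr: "Z2_grading Mp Mm" and lin: "linear F" "linear H"
    and hom: "\<And>x y. x \<in> Mp \<or> x \<in> Mm \<Longrightarrow> F (tens x y) = H (tens x y)"
  shows "F = H"
proof (rule tensor_linear_unique[OF lin])
  fix x y
  obtain p q where "p \<in> Mp" "q \<in> Mm" "x = p + q" using gr unfolding Z2_grading_def by meson
  then show "F (tens x y) = H (tens x y)"
    using hom by (simp add: tens_add_left linear_add[OF lin(1)] linear_add[OF lin(2)])
qed

lemma tensor_map_clifford_condition:
  fixes c :: "'v::real_vector \<Rightarrow> 'a \<Rightarrow> 'a::real_vector"
  assumes c: "clifford_condition V g c" and V: "subspace V"
  shows "clifford_condition V g (\<lambda>v. tensor_map (c v) (id :: 'b::real_vector \<Rightarrow> 'b))"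
proof -
  let ?T = "\<lambda>v. tensor_map (c v) (id :: 'b \<Rightarrow> 'b)"
  have lin: "linear (?T v)" and tens: "?T v (tens x y) = tens (c v x) y" if "v \<in> V" for v x y
    using tensor_map[OF clifford_conditionD(1)[OF c that] linear_id] by simp_all
  have "?T (v + w) = (\<lambda>t. ?T v t + ?T w t)" if "v \<in> V" "w \<in> V" for v w
    using that by (intro tensor_linear_unique linear_compose_add)
      (simp_all add: lin tens subspace_add[OF V] clifford_conditionD(2)[OF c] tens_add_left)
  moreover have "?T (a *\<^sub>R v) = (\<lambda>t. a *\<^sub>R ?T v t)" if "v \<in> V" for a v
    using that by (intro tensor_linear_unique linear_compose_scale_right)
      (simp_all add: lin tens subspace_scale[OF V] clifford_conditionD(3)[OF c] tens_scale_left)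
  moreover have "(\<lambda>t. ?T v (?T w t) + ?T w (?T v t)) = (\<lambda>t. (- 2 * g v w) *\<^sub>R t)"
    if v: "v \<in> V" and w: "w \<in> V" for v w
  proof (rule tensor_linear_unique)
    show "linear (\<lambda>t. ?T v (?T w t) + ?T w (?T v t))"
      using linear_compose[OF lin[OF w] lin[OF v]] linear_compose[OF lin[OF v] lin[OF w]]
      by (intro linear_compose_add) (simp_all add: o_def)
    show "linear (\<lambda>t. (- 2 * g v w) *\<^sub>R t :: ('a, 'b) tensor)"
      by (rule linear_compose_scale_right[OF linear_id, unfolded id_def])
    show "?T v (?T w (tens x y)) + ?T w (?T v (tens x y)) = (- 2 * g v w) *\<^sub>R tens x y" for x y
      unfolding tens[OF v] tens[OF w] tens_add_left[symmetric] clifford_conditionD(4)[OF c v w]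
        tens_scale_left ..
  qed
  ultimately show ?thesis unfolding clifford_condition_def using lin by (simp add: fun_eq_iff)
qed

lemma graded_tensor_map_clifford_condition:
  fixes d :: "'v::real_vector \<Rightarrow> 'b \<Rightarrow> 'b::real_vector" and Mp Mm :: "'a::real_vector set"
  assumes d: "clifford_condition V g d" and V: "subspace V" and gr: "Z2_grading Mp Mm"
  shows "clifford_condition V g (\<lambda>v. graded_tensor_map Mp Mm (d v))"
proof -
  let ?T = "\<lambda>v. graded_tensor_map Mp Mm (d v)"
  have lin: "linear (?T v)" and plus: "x \<in> Mp \<Longrightarrow> ?T v (tens x y) = tens x (d v y)"
    and minus: "x \<in> Mm \<Longrightarrow> ?T v (tens x y) = - tens x (d v y)" if "v \<in> V" for v x y
    using graded_tensor_map[OF gr clifford_conditionD(1)[OF d that]] by simp_all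
  have "?T (v + w) = (\<lambda>t. ?T v t + ?T w t)" if "v \<in> V" "w \<in> V" for v w
    using that by (intro tensor_linear_unique_graded[OF gr] linear_compose_add)
      (auto simp: lin plus minus subspace_add[OF V] clifford_conditionD(2)[OF d] tens_add_right)
  moreover have "?T (a *\<^sub>R v) = (\<lambda>t. a *\<^sub>R ?T v t)" if "v \<in> V" for a v
    using that by (intro tensor_linear_unique_graded[OF gr] linear_compose_scale_right)
      (auto simp: lin plus minus subspace_scale[OF V] clifford_conditionD(3)[OF d] tens_scale_right)
  moreover have "(\<lambda>t. ?T v (?T w t) + ?T w (?T v t)) = (\<lambda>t. (- 2 * g v w) *\<^sub>R t)"
    if v: "v \<in> V" and w: "w \<in> V" for v w
  proof (rule tensor_linear_unique_graded[OF gr])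
    show "linear (\<lambda>t. ?T v (?T w t) + ?T w (?T v t))"
      using linear_compose[OF lin[OF w] lin[OF v]] linear_compose[OF lin[OF v] lin[OF w]]
      by (intro linear_compose_add) (simp_all add: o_def)
    show "linear (\<lambda>t. (- 2 * g v w) *\<^sub>R t :: ('a, 'b) tensor)"
      by (rule linear_compose_scale_right[OF linear_id, unfolded id_def])
    fix x :: 'a and y
    assume x: "x \<in> Mp \<or> x \<in> Mm"
    have "?T v (?T w (tens x y)) + ?T w (?T v (tens x y)) = tens x (d v (d w y)) + tens x (d w (d v y))"
      using x by (elim disjE)
        (simp_all add: plus[OF v] plus[OF w] minus[OF v] minus[OF w] linear_neg[OF lin[OF v]] linear_neg[OF lin[OF w]])
    then show "?T v (?T w (tens x y)) + ?T w (?T v (tens x y)) = (- 2 * g v w) *\<^sub>R tens x y"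
      unfolding tens_add_right[symmetric] clifford_conditionD(4)[OF d v w] tens_scale_right .
  qed
  ultimately show ?thesis unfolding clifford_condition_def using lin by (simp add: fun_eq_iff)
qed

lemma graded_tensor_map_anticommute:
  assumes gr: "Z2_grading Mp Mm" and f: "linear f" "f ` Mp \<subseteq> Mm" "f ` Mm \<subseteq> Mp" and T: "linear T"
  shows "graded_tensor_map Mp Mm T (tensor_map f id t) = - tensor_map f id (graded_tensor_map Mp Mm T t)"
proof -
  note G = graded_tensor_map[OF gr T] and M = tensor_map[OF f(1) linear_id]
  have "(\<lambda>t. graded_tensor_map Mp Mm T (tensor_map f id t)) =
      (\<lambda>t. - tensor_map f id (graded_tensor_map Mp Mm T t))"
  proof (rule tensor_linear_unique_graded[OF gr])
    show "linear (\<lambda>t. graded_tensor_map Mp Mm T (tensor_map f id t))"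
      using linear_compose[OF M(1) G(1)] by (simp add: o_def)
    show "linear (\<lambda>t. - tensor_map f id (graded_tensor_map Mp Mm T t))"
      using linear_compose_neg[OF linear_compose[OF G(1) M(1)]] by (simp add: o_def)
    fix x y assume "x \<in> Mp \<or> x \<in> Mm"
    then show "graded_tensor_map Mp Mm T (tensor_map f id (tens x y)) =
        - tensor_map f id (graded_tensor_map Mp Mm T (tens x y))"
    proof
      assume x: "x \<in> Mp"
      then have "f x \<in> Mm" using f(2) by blast
      then show ?thesis using x by (simp add: M(2) G(2,3))
    next
      assume x: "x \<in> Mm"
      then have "f x \<in> Mp" using f(3) by blast
      then show ?thesis using x by (simp add: M(2) G(2,3) linear_neg[OF M(1)])
    qed
  qed
  then show ?thesis by (rule fun_cong)
qed

section \<open>The splitting of the quadratic space\<close>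

lemma split_vec_add:
  assumes "split_vec r s v = (u, x)" "split_vec r s w = (u', x')"
  shows "split_vec r s (v + w) = (u + u', x + x')"
  using assms
  by (auto simp: split_vec_def Let_def lookup_vec_of lookup_add intro!: poly_mapping_eqI)

lemma split_vec_scale:
  assumes "split_vec r s v = (u, x)"
  shows "split_vec r s (t *\<^sub>R v) = (t *\<^sub>R u, t *\<^sub>R x)"
  using assms
  by (auto simp: split_vec_def Let_def lookup_vec_of lookup_scaleR_real intro!: poly_mapping_eqI)

lemma split_vec_mem:
  assumes "i = min r s" "v \<in> Rn (r + s)" "split_vec r s v = (u, x)"
  shows "u \<in> Rn (i + i)" "x \<in> Rn ((r - i) + (s - i))"
  using bij_betwE[OF split_vec_bij[of r s]] assms by (auto simp: mult_2)

lemma split_vec_surj: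
  assumes "i = min r s" "u \<in> Rn (i + i)" "x \<in> Rn ((r - i) + (s - i))"
  obtains v where "v \<in> Rn (r + s)" "split_vec r s v = (u, x)"
proof -
  have "(u, x) \<in> split_vec r s ` Rn (r + s)"
    using bij_betw_imp_surj_on[OF split_vec_bij[of r s]] assms by (simp add: mult_2)
  then show ?thesis using that by (metis imageE)
qed

lemma clifford_map_zero:
  assumes "clifford_condition V g c" "subspace V"
  shows "c 0 x = 0"
  using clifford_conditionD(3)[OF assms(1) subspace_0[OF assms(2)], of 0 x] by simp

lemma Z2_grading_unique:
  assumes gr: "Z2_grading Mp Mm" and eq: "p + q = p' + q'"
    and mem: "p \<in> Mp" "p' \<in> Mp" "q \<in> Mm" "q' \<in> Mm"
  shows "p = p'" "q = q'"
proof -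
  have sub: "subspace Mp" "subspace Mm" and int: "Mp \<inter> Mm = {0}"
    using gr by (auto simp: Z2_grading_def)
  have "p - p' = q' - q" using eq by (simp add: algebra_simps)
  moreover have "p - p' \<in> Mp" "q' - q \<in> Mm" using mem by (auto intro: subspace_diff sub)
  ultimately have "p - p' \<in> Mp \<inter> Mm" by simp
  then show "p = p'" using int by simp
  then show "q = q'" using eq by simp
qed

section \<open>The graded tensor product of modules\<close>

locale graded_factor =
  fixes r s i :: nat and c :: "(nat \<Rightarrow>\<^sub>0 real) \<Rightarrow> 'a \<Rightarrow> 'a::real_vector" and Mp Mm :: "'a set"
  assumes i_min: "i = min r s"
    and cond: "clifford_condition (Rn (i + i)) (gform i i) c"
    and irr: "irreducible_map (Rn (i + i)) c"
    and gr: "Z2_grading Mp Mm"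
    and odd_plus: "v \<in> Rn (i + i) \<Longrightarrow> c v ` Mp \<subseteq> Mm"
    and odd_minus: "v \<in> Rn (i + i) \<Longrightarrow> c v ` Mm \<subseteq> Mp"
begin

abbreviation "product d \<equiv> product_clifford_map r s c Mp Mm d"
abbreviation "left_map u \<equiv> tensor_map (c u) id"
abbreviation "right_map T \<equiv> graded_tensor_map Mp Mm T"

lemma product_eq: "split_vec r s v = (u, x) \<Longrightarrow> product d v t = left_map u t + right_map (d x) t"
  by (simp add: product_clifford_map_def)

lemma product_clifford_condition:
  assumes d: "clifford_condition (Rn ((r - i) + (s - i))) (gform (r - i) (s - i)) d"
  shows "clifford_condition (Rn (r + s)) (gform r s) (product d)"
proof -
  note L = tensor_map_clifford_condition[OF cond subspace_Rn]
  note R = graded_tensor_map_clifford_condition[OF d subspace_Rn gr]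
  have split: "\<exists>u x. split_vec r s v = (u, x) \<and> u \<in> Rn (i + i) \<and> x \<in> Rn ((r - i) + (s - i))"
    if "v \<in> Rn (r + s)" for v
    using split_vec_mem[OF i_min that] by (metis surj_pair)
  have anti: "right_map (d x) (left_map u t) = - left_map u (right_map (d x) t)"
    if "u \<in> Rn (i + i)" "x \<in> Rn ((r - i) + (s - i))" for u x t
    by (rule graded_tensor_map_anticommute[OF gr clifford_conditionD(1)[OF cond that(1)]
          odd_plus[OF that(1)] odd_minus[OF that(1)] clifford_conditionD(1)[OF d that(2)]])
  show ?thesis
    unfolding clifford_condition_def
  proof (intro conjI ballI allI)
    fix v w t a
    assume v: "v \<in> Rn (r + s)"
    obtain u x where v': "split_vec r s v = (u, x)" "u \<in> Rn (i + i)" "x \<in> Rn ((r - i) + (s - i))"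
      using split[OF v] by blast
    note linu = clifford_conditionD(1)[OF L v'(2)] and linx = clifford_conditionD(1)[OF R v'(3)]
    have Dv: "product d v = (\<lambda>t. left_map u t + right_map (d x) t)"
      using product_eq[OF v'(1)] by blast
    show "linear (product d v)" unfolding Dv by (rule linear_compose_add[OF linu linx])
    show "product d (a *\<^sub>R v) t = a *\<^sub>R product d v t"
      unfolding product_eq[OF v'(1)] product_eq[OF split_vec_scale[OF v'(1)]]
        clifford_conditionD(3)[OF L v'(2)] clifford_conditionD(3)[OF R v'(3)] scaleR_add_right ..
    assume w: "w \<in> Rn (r + s)"
    obtain u' x' where w': "split_vec r s w = (u', x')" "u' \<in> Rn (i + i)" "x' \<in> Rn ((r - i) + (s - i))"
      using split[OF w] by blast
    note linu' = clifford_conditionD(1)[OF L w'(2)] and linx' = clifford_conditionD(1)[OF R w'(3)]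
    show "product d (v + w) t = product d v t + product d w t"
      unfolding product_eq[OF v'(1)] product_eq[OF w'(1)] product_eq[OF split_vec_add[OF v'(1) w'(1)]]
        clifford_conditionD(2)[OF L v'(2) w'(2)] clifford_conditionD(2)[OF R v'(3) w'(3)]
      by (simp only: ac_simps)
    have "product d v (product d w t) + product d w (product d v t) =
        (left_map u (left_map u' t) + left_map u' (left_map u t)) +
        (right_map (d x) (right_map (d x') t) + right_map (d x') (right_map (d x) t)) +
        (left_map u (right_map (d x') t) + right_map (d x') (left_map u t)) +
        (left_map u' (right_map (d x) t) + right_map (d x) (left_map u' t))"
      unfolding product_eq[OF v'(1)] product_eq[OF w'(1)]
        linear_add[OF linu] linear_add[OF linu'] linear_add[OF linx] linear_add[OF linx']
      by (simp only: ac_simps)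
    also have "\<dots> = (- 2 * gform i i u u') *\<^sub>R t + (- 2 * gform (r - i) (s - i) x x') *\<^sub>R t"
      unfolding clifford_conditionD(4)[OF L v'(2) w'(2)] clifford_conditionD(4)[OF R v'(3) w'(3)]
        anti[OF v'(2) w'(3)] anti[OF w'(2) v'(3)] by simp
    also have "\<dots> = (- 2 * gform r s v w) *\<^sub>R t"
      using split_vec_isometry[OF v'(1) w'(1)]
      by (simp add: i_min scaleR_add_left[symmetric] distrib_left del: scaleR_minus_left)
    finally show "product d v (product d w t) + product d w (product d v t) = (- 2 * gform r s v w) *\<^sub>R t" .
  qed
qed

lemma product_left:
  assumes d: "clifford_condition (Rn ((r - i) + (s - i))) g d" and v: "split_vec r s v = (u, 0)"
  shows "product d v t = left_map u t"
proof -
  have "right_map (d 0) t = 0"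
    by (rule clifford_map_zero[OF graded_tensor_map_clifford_condition[OF d subspace_Rn gr] subspace_Rn])
  then show ?thesis by (simp add: product_eq[OF v])
qed

lemma product_right:
  assumes v: "split_vec r s v = (0, x)"
  shows "product d v t = right_map (d x) t"
proof -
  have "left_map 0 t = 0"
    by (rule clifford_map_zero[OF tensor_map_clifford_condition[OF cond subspace_Rn] subspace_Rn])
  then show ?thesis by (simp add: product_eq[OF v])
qed

lemma split_vec_left:
  assumes "u \<in> Rn (i + i)"
  obtains v where "v \<in> Rn (r + s)" "split_vec r s v = (u, 0)"
  using split_vec_surj[OF i_min assms subspace_0[OF subspace_Rn]] .

lemma split_vec_right:
  assumes "x \<in> Rn ((r - i) + (s - i))"
  obtains v where "v \<in> Rn (r + s)" "split_vec r s v = (0, x)"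
  using split_vec_surj[OF i_min subspace_0[OF subspace_Rn] assms] .

text \<open>
  The involutions are even operators, so the homogeneous components of a fixed vector are fixed.
  Homogeneity makes the graded action of the right factor on \<open>x0 \<otimes> y\<close> a plain action up to one
  global sign, which affects neither submodules nor intertwiners.
\<close>

lemma exists_vacuum:
  obtains x0 where "x0 \<noteq> 0" "\<And>k. k < i \<Longrightarrow> basis_op c k (basis_op c (i + k) x0) = x0"
    "x0 \<in> Mp \<or> x0 \<in> Mm"
proof -
  note E = clifford_condition_anticommuting[OF cond]
  obtain z :: 'a where "z \<noteq> 0" by (rule irreducible_map_nonzero[OF irr])
  then obtain x where x: "x \<noteq> 0" "\<And>k. k < i \<Longrightarrow> basis_op c k (basis_op c (i + k) x) = x"
    using exists_fixed_vector[OF E subspace_UNIV UNIV_I UNIV_I] by blast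
  obtain p q where pq: "p \<in> Mp" "q \<in> Mm" "x = p + q" using gr unfolding Z2_grading_def by meson
  have fixed: "basis_op c k (basis_op c (i + k) p) = p" "basis_op c k (basis_op c (i + k) q) = q"
    if k: "k < i" for k
  proof -
    let ?P = "\<lambda>x. basis_op c k (basis_op c (i + k) x)"
    have mem: "Poly_Mapping.single k 1 \<in> Rn (i + i)" "Poly_Mapping.single (i + k) 1 \<in> Rn (i + i)"
      using k by (auto intro: single_in_Rn)
    have P: "?P p \<in> Mp" "?P q \<in> Mm"
      using pq odd_plus[OF mem(1)] odd_plus[OF mem(2)] odd_minus[OF mem(1)] odd_minus[OF mem(2)]
      by blast+
    have "?P p + ?P q = p + q"
      using x(2)[OF k] hyperbolic_pairD(1,2)[OF E k] by (simp add: pq(3) linear_add)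
    from Z2_grading_unique[OF gr this P(1) pq(1) P(2) pq(2)] show "?P p = p" "?P q = q" .
  qed
  have "p \<noteq> 0 \<or> q \<noteq> 0" using x(1) pq(3) by auto
  then show ?thesis using that[of p] that[of q] fixed pq(1,2) by blast
qed

lemma right_map_homogeneous:
  assumes "x0 \<in> Mp \<or> x0 \<in> Mm" "linear T"
  shows "right_map T (tens x0 y) = (if x0 \<in> Mp then 1 else -1) *\<^sub>R tens x0 (T y)"
  using assms(1) graded_tensor_map(2,3)[OF gr assms(2), of x0 y] by auto

lemma left_map_tens: "u \<in> Rn (i + i) \<Longrightarrow> left_map u (tens x y) = tens (c u x) y"
  using tensor_map(2)[OF clifford_conditionD(1)[OF cond, of u] linear_id] by simp

lemma left_map_anticommuting:
  "anticommuting (i + i) (basis_sign i) (basis_op (\<lambda>u. tensor_map (c u) (id :: 'b::real_vector \<Rightarrow> 'b)))"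
  by (rule clifford_condition_anticommuting[OF tensor_map_clifford_condition[OF cond subspace_Rn]])

text \<open>
  The vectors of the product fixed by all involutions are exactly the \<open>x0 \<otimes> y\<close>: the module
  generated by them contains \<open>x \<otimes> y\<close> for all \<open>x\<close> in a submodule of the irreducible left factor.
\<close>

lemma fixed_tensor:
  fixes t :: "('a, 'b::real_vector) tensor"
  assumes x0: "x0 \<noteq> 0" "\<And>k. k < i \<Longrightarrow> basis_op c k (basis_op c (i + k) x0) = x0"
    and t: "\<And>k. k < i \<Longrightarrow> basis_op left_map k (basis_op left_map (i + k) t) = t"
  shows "\<exists>y. t = tens x0 y"
proof -
  let ?E = "basis_op (\<lambda>u. tensor_map (c u) (id :: 'b \<Rightarrow> 'b))"
  have E_tens: "?E j (tens x y) = tens (basis_op c j x) y" if "j < i + i" for j x y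
    using left_map_tens[OF single_in_Rn[OF that]] .
  have sub: "subspace (range (tens x0 :: 'b \<Rightarrow> _))"
    by (rule linear_subspace_image[OF linear_tens(1) subspace_UNIV])
  have "?E k (?E (i + k) w) = w" if "k < i" "w \<in> range (tens x0)" for k w
  proof -
    obtain y where w: "w = tens x0 y" using \<open>w \<in> range (tens x0)\<close> by blast
    have j: "k < i + i" "i + k < i + i" using \<open>k < i\<close> by auto
    show ?thesis unfolding w E_tens[OF j(1)] E_tens[OF j(2)] x0(2)[OF \<open>k < i\<close>] ..
  qed
  from exists_hyperbolic_extension[OF left_map_anticommuting sub this]
  obtain R where "subspace R \<and> range (tens x0 :: 'b \<Rightarrow> _) \<subseteq> R \<and> (\<forall>j<i + i. \<forall>w\<in>R. ?E j w \<in> R) \<and>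
    (\<forall>w\<in>R. (\<forall>k<i. ?E k (?E (i + k) w) = w) \<longrightarrow> w \<in> range (tens x0 :: 'b \<Rightarrow> _))"
    by (rule exE)
  note R = this[THEN conjunct1] this[THEN conjunct2, THEN conjunct1]
    this[THEN conjunct2, THEN conjunct2, THEN conjunct1]
    this[THEN conjunct2, THEN conjunct2, THEN conjunct2]
  \<comment> \<open>The left vectors whose tensors all lie in \<open>R\<close> form a submodule containing \<open>x0\<close>.\<close>
  let ?X = "{x. \<forall>y. tens x y \<in> R}"
  have "subspace ?X"
    using R(1) by (auto simp: subspace_def tens_add_left tens_scale_left)
  moreover have "c v x \<in> ?X" if v: "v \<in> Rn (i + i)" and x: "x \<in> ?X" for v x
  proof -
    have "tens (basis_op c j x) y \<in> R" if "j < i + i" for j y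
      using R(3)[rule_format, OF that, of "tens x y"] x by (simp add: E_tens[OF that])
    then have "basis_op c j x \<in> ?X" if "j < i + i" for j using that by blast
    then show ?thesis
      unfolding clifford_map_sum[OF cond v]
      by (intro subspace_sum subspace_scale \<open>subspace ?X\<close>) auto
  qed
  ultimately have "invariant_subspace (Rn (i + i)) c ?X" by (simp add: invariant_subspace_def)
  moreover have "x0 \<in> ?X" using R(2) by auto
  ultimately have "?X = UNIV" using x0(1) by (rule irreducible_map_UNIV[OF irr])
  then have "R = UNIV" by (intro subspace_containing_tens[OF R(1)]) blast
  then have "t \<in> range (tens x0)" using R(4)[rule_format, of t, OF _ t] by simp
  then show ?thesis by blast
qed

text \<open>
  A nonzero submodule contains some \<open>x0 \<otimes> y\<close> with \<open>y \<noteq> 0\<close>; irreducibility of the right factor gives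
  all of \<open>x0 \<otimes> y\<close>, and irreducibility of the left factor then gives everything.
\<close>

lemma product_irreducible:
  fixes d :: "(nat \<Rightarrow>\<^sub>0 real) \<Rightarrow> 'b \<Rightarrow> 'b::real_vector"
  assumes d: "clifford_condition (Rn ((r - i) + (s - i))) g d"
    and d_irr: "irreducible_map (Rn ((r - i) + (s - i))) d"
  shows "irreducible_map (Rn (r + s)) (product d)"
proof -
  obtain x0 where x0: "x0 \<noteq> 0" "\<And>k. k < i \<Longrightarrow> basis_op c k (basis_op c (i + k) x0) = x0"
    and hom: "x0 \<in> Mp \<or> x0 \<in> Mm"
    by (rule exists_vacuum, rule that)
  define \<epsilon> where "\<epsilon> = (if x0 \<in> Mp then 1 else -1::real)"
  have \<epsilon>: "\<epsilon> = 1 \<or> \<epsilon> = -1" by (simp add: \<epsilon>_def)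
  note right = right_map_homogeneous[OF hom, folded \<epsilon>_def]
  have "U = UNIV" if U: "invariant_subspace (Rn (r + s)) (product d) U" and nz: "U \<noteq> {0}" for U
  proof -
    have sub: "subspace U" and inv: "\<And>v t. v \<in> Rn (r + s) \<Longrightarrow> t \<in> U \<Longrightarrow> product d v t \<in> U"
      using U by (auto simp: invariant_subspace_def)
    have left_inv: "left_map u t \<in> U" if u: "u \<in> Rn (i + i)" and t: "t \<in> U" for u t
    proof -
      obtain v where "v \<in> Rn (r + s)" "split_vec r s v = (u, 0)" using split_vec_left[OF u] .
      then show ?thesis using inv[of v t] t product_left[OF d, of v u t] by simp
    qed
    have right_inv: "right_map (d x) t \<in> U" if x: "x \<in> Rn ((r - i) + (s - i))" and t: "t \<in> U" for x t
    proof -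
      obtain v where "v \<in> Rn (r + s)" "split_vec r s v = (0, x)" using split_vec_right[OF x] .
      then show ?thesis using inv[of v t] t product_right[of v x d t] by simp
    qed
    obtain t0 where "t0 \<in> U" "t0 \<noteq> 0" using nz subspace_0[OF sub] by blast
    then obtain t where t: "t \<in> U" "t \<noteq> 0"
      "\<And>k. k < i \<Longrightarrow> basis_op left_map k (basis_op left_map (i + k) t) = t"
      using exists_fixed_vector[OF left_map_anticommuting sub left_inv[OF single_in_Rn]] by blast
    \<comment> \<open>A fixed vector of the submodule supplies a nonzero element of the submodule \<open>?B\<close> of the right factor.\<close>
    obtain y0 where y0: "t = tens x0 y0" using fixed_tensor[OF x0 t(3)] by blast
    let ?B = "{y. tens x0 y \<in> U}"
    have "subspace ?B"
      using sub by (auto simp: subspace_def tens_add_right tens_scale_right)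
    moreover have "d x y \<in> ?B" if x: "x \<in> Rn ((r - i) + (s - i))" and y: "y \<in> ?B" for x y
    proof -
      have "\<epsilon> *\<^sub>R tens x0 (d x y) \<in> U"
        using right_inv[OF x, of "tens x0 y"] y right[OF clifford_conditionD(1)[OF d x]] by simp
      from subspace_scale[OF sub this, of \<epsilon>] show ?thesis using \<epsilon> by auto
    qed
    ultimately have "invariant_subspace (Rn ((r - i) + (s - i))) d ?B"
      by (simp add: invariant_subspace_def)
    moreover have "y0 \<in> ?B" "y0 \<noteq> 0" using t y0 by auto
    ultimately have B: "?B = UNIV" by (rule irreducible_map_UNIV[OF d_irr])
    let ?X = "{x. \<forall>y. tens x y \<in> U}"
    have "subspace ?X"
      using sub by (auto simp: subspace_def tens_add_left tens_scale_left)
    moreover have "c v x \<in> ?X" if v: "v \<in> Rn (i + i)" and x: "x \<in> ?X" for v x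
      using left_inv[OF v] x by (auto simp flip: left_map_tens[OF v])
    ultimately have "invariant_subspace (Rn (i + i)) c ?X" by (simp add: invariant_subspace_def)
    moreover have "x0 \<in> ?X" using B by blast
    ultimately have "?X = UNIV" using x0(1) by (rule irreducible_map_UNIV[OF irr])
    then show ?thesis by (intro subspace_containing_tens[OF sub]) blast
  qed
  moreover have "\<exists>t :: ('a, 'b) tensor. t \<noteq> 0"
  proof -
    obtain y :: 'b where "y \<noteq> 0" by (rule irreducible_map_nonzero[OF d_irr])
    then show ?thesis using x0(1) by (intro exI[of _ "tens x0 y"]) (simp add: tens_eq_0_iff)
  qed
  ultimately show ?thesis unfolding irreducible_map_def by blast
qed

text \<open>
  An intertwiner of products preserves the vectors fixed by the involutions, and on these it is
  a map between the right factors. The sign of the vacuum is the same on both sides and cancels.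
\<close>

lemma product_intertwiner:
  fixes d :: "(nat \<Rightarrow>\<^sub>0 real) \<Rightarrow> 'b \<Rightarrow> 'b::real_vector"
    and d' :: "(nat \<Rightarrow>\<^sub>0 real) \<Rightarrow> 'c \<Rightarrow> 'c::real_vector"
  assumes d: "clifford_condition (Rn ((r - i) + (s - i))) g d"
    and d': "clifford_condition (Rn ((r - i) + (s - i))) g d'"
    and f: "intertwiner (Rn (r + s)) (product d) (product d') f" "inj f"
    and y: "y \<noteq> (0::'b)"
  shows "\<exists>h. intertwiner (Rn ((r - i) + (s - i))) d d' h \<and> h y \<noteq> 0"
proof -
  obtain x0 where x0: "x0 \<noteq> 0" "\<And>k. k < i \<Longrightarrow> basis_op c k (basis_op c (i + k) x0) = x0"
    and hom: "x0 \<in> Mp \<or> x0 \<in> Mm"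
    by (rule exists_vacuum, rule that)
  define \<epsilon> where "\<epsilon> = (if x0 \<in> Mp then 1 else -1::real)"
  have \<epsilon>: "\<epsilon> = 1 \<or> \<epsilon> = -1" by (simp add: \<epsilon>_def)
  note right = right_map_homogeneous[OF hom, folded \<epsilon>_def]
  have lf: "linear f" and tw: "\<And>v t. v \<in> Rn (r + s) \<Longrightarrow> f (product d v t) = product d' v (f t)"
    using f(1) by (auto simp: intertwiner_def)
  have f_left: "f (left_map u t) = left_map u (f t)" if u: "u \<in> Rn (i + i)" for u t
  proof -
    obtain v where v: "v \<in> Rn (r + s)" "split_vec r s v = (u, 0)" using split_vec_left[OF u] .
    show ?thesis using tw[OF v(1), of t] product_left[OF d v(2)] product_left[OF d' v(2)] by simp
  qed
  have f_right: "f (right_map (d x) t) = right_map (d' x) (f t)"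
    if x: "x \<in> Rn ((r - i) + (s - i))" for x t
  proof -
    obtain v where v: "v \<in> Rn (r + s)" "split_vec r s v = (0, x)" using split_vec_right[OF x] .
    show ?thesis
      using tw[OF v(1), of t] product_right[OF v(2), of d] product_right[OF v(2), of d'] by simp
  qed
  have "\<exists>z. f (tens x0 y) = tens x0 z" for y
  proof (rule fixed_tensor[OF x0])
    fix k assume k: "k < i"
    then have mem: "Poly_Mapping.single k 1 \<in> Rn (i + i)" "Poly_Mapping.single (i + k) 1 \<in> Rn (i + i)"
      by (auto intro: single_in_Rn)
    show "basis_op left_map k (basis_op left_map (i + k) (f (tens x0 y))) = f (tens x0 y)"
      by (simp only: left_map_tens[OF mem(1)] left_map_tens[OF mem(2)] x0(2)[OF k]
          flip: f_left[OF mem(1)] f_left[OF mem(2)])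
  qed
  then obtain h where h: "\<And>y. f (tens x0 y) = tens x0 (h y)" by metis
  have "linear h"
  proof (rule linearI)
    fix a b t
    show "h (a + b) = h a + h b"
      using linear_add[OF lf, of "tens x0 a" "tens x0 b"]
      by (simp add: h tens_left_cancel[OF x0(1)] flip: tens_add_right)
    show "h (t *\<^sub>R a) = t *\<^sub>R h a"
      using linear_scale[OF lf, of t "tens x0 a"]
      by (simp add: h tens_left_cancel[OF x0(1)] flip: tens_scale_right)
  qed
  moreover have "h (d x y) = d' x (h y)" if x: "x \<in> Rn ((r - i) + (s - i))" for x y
  proof -
    have "f (\<epsilon> *\<^sub>R tens x0 (d x y)) = \<epsilon> *\<^sub>R tens x0 (d' x (h y))"
      using f_right[OF x, of "tens x0 y"]
      by (simp only: right[OF clifford_conditionD(1)[OF d x]] right[OF clifford_conditionD(1)[OF d' x]] h)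
    then show ?thesis
      using \<epsilon> by (auto simp: linear_scale[OF lf] linear_neg[OF lf] h tens_left_cancel[OF x0(1)])
  qed
  moreover have "h y \<noteq> 0"
  proof
    assume "h y = 0"
    then have "f (tens x0 y) = f 0" by (simp add: h linear_0[OF lf])
    then have "tens x0 y = 0" by (rule injD[OF f(2)])
    then show False using x0(1) y by (simp add: tens_eq_0_iff)
  qed
  ultimately show ?thesis unfolding intertwiner_def by blast
qed

end

section \<open>Irreducible modules over \<open>Cl\<^bsub>r,s\<^esub>\<close>\<close>

lemma Cl_irreducibleD:
  assumes "Cl_irreducible r s \<rho>"
  shows "clifford_module (Rn (r + s)) (gform r s) \<rho>"
    "clifford_condition (Rn (r + s)) (gform r s) (Cl_map r s \<rho>)"
    "irreducible_map (Rn (r + s)) (Cl_map r s \<rho>)"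
proof -
  show \<rho>: "clifford_module (Rn (r + s)) (gform r s) \<rho>"
    using assms by (simp add: irreducible_clifford_module_def)
  show "clifford_condition (Rn (r + s)) (gform r s) (Cl_map r s \<rho>)"
    by (rule clifford_condition_module_map[OF subspace_Rn \<rho>])
  show "irreducible_map (Rn (r + s)) (Cl_map r s \<rho>)"
    using assms irreducible_clifford_module_iff[OF subspace_Rn \<rho>] by simp
qed

lemma Cl_isomorphic_iff:
  assumes "Cl_irreducible r s \<rho>" "Cl_irreducible r s \<sigma>"
  shows "Cl_isomorphic r s \<rho> \<sigma> \<longleftrightarrow>
    (\<exists>f. bij f \<and> intertwiner (Rn (r + s)) (Cl_map r s \<rho>) (Cl_map r s \<sigma>) f)"
  by (rule isomorphic_clifford_modules_iff[OF subspace_Rn Cl_irreducibleD(1)[OF assms(1)]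
        Cl_irreducibleD(1)[OF assms(2)]])

lemma irreducible_map_cong:
  assumes "\<And>v. v \<in> V \<Longrightarrow> c v = d v"
  shows "irreducible_map V c \<longleftrightarrow> irreducible_map V d"
proof -
  have "invariant_subspace V c U \<longleftrightarrow> invariant_subspace V d U" for U
    unfolding invariant_subspace_def by (metis assms)
  then show ?thesis unfolding irreducible_map_def by simp
qed

lemma Cl_module_exists:
  assumes c: "clifford_condition (Rn (r + s)) (gform r s) c" and irr: "irreducible_map (Rn (r + s)) c"
  obtains \<sigma> where "Cl_has_map r s \<sigma> c" "Cl_irreducible r s \<sigma>"
proof -
  obtain \<sigma> where \<sigma>: "Cl_has_map r s \<sigma> c" using clifford_module_exists[OF subspace_Rn c] by blast
  have mod: "clifford_module (Rn (r + s)) (gform r s) \<sigma>"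
    and eq: "\<And>v. v \<in> Rn (r + s) \<Longrightarrow> Cl_map r s \<sigma> v = c v"
    using \<sigma> by (simp_all add: has_clifford_map_def)
  have "Cl_irreducible r s \<sigma>"
    unfolding irreducible_clifford_module_iff[OF subspace_Rn mod]
    using irreducible_map_cong[of "Rn (r + s)" "Cl_map r s \<sigma>" c] eq irr by blast
  then show ?thesis using that[OF \<sigma>] by blast
qed

lemma Cl_has_map_intertwiner:
  assumes "Cl_has_map r s \<rho> c" "Cl_has_map r s \<sigma> d"
  shows "intertwiner (Rn (r + s)) (Cl_map r s \<rho>) (Cl_map r s \<sigma>) f \<longleftrightarrow> intertwiner (Rn (r + s)) c d f"
  using assms by (simp add: has_clifford_map_def intertwiner_def)

lemma Cl_nonchiral_isomorphic:
  assumes "\<not> chiral r s" "Cl_irreducible r s \<tau>" "Cl_irreducible r s \<sigma>"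
  shows "Cl_isomorphic r s \<tau> \<sigma>"
  unfolding Cl_isomorphic_iff[OF assms(2,3)]
  by (rule nonchiral_isomorphic[OF Cl_irreducibleD(2,3)[OF assms(2)] Cl_irreducibleD(2,3)[OF assms(3)] assms(1)])

lemma Cl_chiral_isomorphic:
  assumes ch: "chiral r s" and \<rho>: "Cl_irreducible r s \<rho>" and \<sigma>: "Cl_irreducible r s \<sigma>"
    and w: "\<And>x. volume_element r s (Cl_map r s \<rho>) x = w *\<^sub>R x"
      "\<And>x. volume_element r s (Cl_map r s \<sigma>) x = w *\<^sub>R x"
  shows "Cl_isomorphic r s \<rho> \<sigma>"
proof -
  have "odd (r + s)" using ch by (simp add: chiral_iff)
  then show ?thesis
    unfolding Cl_isomorphic_iff[OF \<rho> \<sigma>]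
    by (rule chiral_isomorphic[OF Cl_irreducibleD(2,3)[OF \<rho>] Cl_irreducibleD(2,3)[OF \<sigma>] _ w])
qed

text \<open>
  Two nonisomorphic irreducible modules realize both chiralities, and any third one shares its
  chirality with one of them.
\<close>

lemma Cl_chiral_cases:
  assumes ch: "chiral r s" and \<sigma>: "Cl_irreducible r s \<sigma>" and \<sigma>': "Cl_irreducible r s \<sigma>'"
    and non: "\<not> Cl_isomorphic r s \<sigma> \<sigma>'" and \<tau>: "Cl_irreducible r s \<tau>"
  shows "Cl_isomorphic r s \<tau> \<sigma> \<or> Cl_isomorphic r s \<tau> \<sigma>'"
proof -
  note sign = chiral_volume[OF Cl_irreducibleD(2,3) ch]
  show ?thesis
    using sign[OF \<sigma> \<sigma>] sign[OF \<sigma>' \<sigma>'] sign[OF \<tau> \<tau>] non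
      Cl_chiral_isomorphic[OF ch \<sigma> \<sigma>'] Cl_chiral_isomorphic[OF ch \<tau> \<sigma>] Cl_chiral_isomorphic[OF ch \<tau> \<sigma>']
    by metis
qed

lemma Cl_chiral_other:
  fixes \<alpha> :: "cl \<Rightarrow> 'n \<Rightarrow> 'n::real_vector"
  assumes ch: "chiral r s" and \<alpha>: "Cl_irreducible r s \<alpha>"
  shows "\<exists>\<alpha>' :: cl \<Rightarrow> 'n \<Rightarrow> 'n. Cl_irreducible r s \<alpha>' \<and> \<not> Cl_isomorphic r s \<alpha> \<alpha>'"
proof -
  let ?c = "Cl_map r s \<alpha>"
  note c = Cl_irreducibleD(2,3)[OF \<alpha>]
  obtain \<alpha>' where \<alpha>': "Cl_has_map r s \<alpha>' (\<lambda>v x. - ?c v x)" "Cl_irreducible r s \<alpha>'"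
    using Cl_module_exists[OF opposite_clifford_condition[OF c(1)] opposite_irreducible[OF c(2)]] .
  have "Cl_has_map r s \<alpha> ?c" using Cl_irreducibleD(1)[OF \<alpha>] by (simp add: has_clifford_map_def)
  then have "\<not> Cl_isomorphic r s \<alpha> \<alpha>'"
    unfolding Cl_isomorphic_iff[OF \<alpha> \<alpha>'(2)]
    using chiral_opposite_not_isomorphic[OF c ch] Cl_has_map_intertwiner[OF _ \<alpha>'(1)] by blast
  then show ?thesis using \<alpha>'(2) by blast
qed

lemma chiral_reduce: "i = min r s \<Longrightarrow> chiral (r - i) (s - i) \<longleftrightarrow> chiral r s"
  unfolding chiral_def by (auto simp: min_def)

context graded_factor
begin

lemma Cl_product:
  assumes "Cl_irreducible (r - i) (s - i) \<alpha>"
  shows "Cl_condition r s (product (Cl_map (r - i) (s - i) \<alpha>))"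
    "irreducible_map (Rn (r + s)) (product (Cl_map (r - i) (s - i) \<alpha>))"
  by (rule product_clifford_condition[OF Cl_irreducibleD(2)[OF assms]],
      rule product_irreducible[OF Cl_irreducibleD(2,3)[OF assms]])

lemma Cl_product_not_isomorphic:
  fixes \<alpha> :: "cl \<Rightarrow> 'n \<Rightarrow> 'n::real_vector"
  assumes \<alpha>: "Cl_irreducible (r - i) (s - i) \<alpha>" and \<alpha>': "Cl_irreducible (r - i) (s - i) \<alpha>'"
    and non: "\<not> Cl_isomorphic (r - i) (s - i) \<alpha> \<alpha>'"
    and \<sigma>: "Cl_has_map r s \<sigma> (product (Cl_map (r - i) (s - i) \<alpha>))" "Cl_irreducible r s \<sigma>"
    and \<sigma>': "Cl_has_map r s \<sigma>' (product (Cl_map (r - i) (s - i) \<alpha>'))" "Cl_irreducible r s \<sigma>'"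
  shows "\<not> Cl_isomorphic r s \<sigma> \<sigma>'"
proof
  assume "Cl_isomorphic r s \<sigma> \<sigma>'"
  then obtain f where f: "bij f" "intertwiner (Rn (r + s)) (product (Cl_map (r - i) (s - i) \<alpha>))
      (product (Cl_map (r - i) (s - i) \<alpha>')) f"
    unfolding Cl_isomorphic_iff[OF \<sigma>(2) \<sigma>'(2)] Cl_has_map_intertwiner[OF \<sigma>(1) \<sigma>'(1)] by blast
  obtain y :: 'n where y: "y \<noteq> 0" by (rule irreducible_map_nonzero[OF Cl_irreducibleD(3)[OF \<alpha>]])
  obtain h where h: "intertwiner (Rn ((r - i) + (s - i))) (Cl_map (r - i) (s - i) \<alpha>) (Cl_map (r - i) (s - i) \<alpha>') h"
    "h y \<noteq> 0"
    using product_intertwiner[OF Cl_irreducibleD(2)[OF \<alpha>] Cl_irreducibleD(2)[OF \<alpha>'] f(2) bij_is_inj[OF f(1)] y]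
    by blast
  have "bij h"
    by (rule schur[OF Cl_irreducibleD(3)[OF \<alpha>] Cl_irreducibleD(3)[OF \<alpha>']
          clifford_conditionD(1)[OF Cl_irreducibleD(2)[OF \<alpha>']] h])
  then show False using non h(1) unfolding Cl_isomorphic_iff[OF \<alpha> \<alpha>'] by blast
qed

lemma Cl_product_classification:
  fixes \<alpha> :: "cl \<Rightarrow> 'n \<Rightarrow> 'n::real_vector"
  assumes p: "p = r - i" and q: "q = s - i" and \<alpha>: "Cl_irreducible p q \<alpha>"
  shows "Cl_condition r s (product (Cl_map p q \<alpha>)) \<and>
    (\<exists>\<sigma>. Cl_has_map r s \<sigma> (product (Cl_map p q \<alpha>)) \<and> Cl_irreducible r s \<sigma> \<and>
      (\<not> chiral p q \<longrightarrow>
        (\<forall>\<tau> :: cl \<Rightarrow> 'w \<Rightarrow> 'w::real_vector. Cl_irreducible r s \<tau> \<longrightarrow> Cl_isomorphic r s \<tau> \<sigma>)) \<and>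
      (chiral p q \<longrightarrow>
        (\<exists>\<alpha>' :: cl \<Rightarrow> 'n \<Rightarrow> 'n. Cl_irreducible p q \<alpha>' \<and> \<not> Cl_isomorphic p q \<alpha> \<alpha>') \<and>
        (\<forall>\<alpha>' :: cl \<Rightarrow> 'p \<Rightarrow> 'p::real_vector.
           Cl_irreducible p q \<alpha>' \<and> \<not> Cl_isomorphic p q \<alpha> \<alpha>' \<longrightarrow>
           Cl_condition r s (product (Cl_map p q \<alpha>')) \<and>
           (\<exists>\<sigma>'. Cl_has_map r s \<sigma>' (product (Cl_map p q \<alpha>')) \<and>
              Cl_irreducible r s \<sigma>' \<and> \<not> Cl_isomorphic r s \<sigma> \<sigma>' \<and>
              (\<forall>\<tau> :: cl \<Rightarrow> 'w \<Rightarrow> 'w. Cl_irreducible r s \<tau> \<longrightarrow>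
                 Cl_isomorphic r s \<tau> \<sigma> \<or> Cl_isomorphic r s \<tau> \<sigma>')))))"
proof -
  note ch = chiral_reduce[OF i_min, folded p q]
  note prod = Cl_product[folded p q]
  obtain \<sigma> where \<sigma>: "Cl_has_map r s \<sigma> (product (Cl_map p q \<alpha>))" "Cl_irreducible r s \<sigma>"
    using Cl_module_exists[OF prod[OF \<alpha>]] .
  have single: "Cl_isomorphic r s \<tau> \<sigma>" if "\<not> chiral p q" "Cl_irreducible r s \<tau>" for \<tau> :: "cl \<Rightarrow> 'w \<Rightarrow> 'w"
    using Cl_nonchiral_isomorphic[OF _ that(2) \<sigma>(2)] that(1) ch by simp
  have double: "Cl_condition r s (product (Cl_map p q \<alpha>')) \<and>
      (\<exists>\<sigma>'. Cl_has_map r s \<sigma>' (product (Cl_map p q \<alpha>')) \<and>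
         Cl_irreducible r s \<sigma>' \<and> \<not> Cl_isomorphic r s \<sigma> \<sigma>' \<and>
         (\<forall>\<tau> :: cl \<Rightarrow> 'w \<Rightarrow> 'w. Cl_irreducible r s \<tau> \<longrightarrow>
            Cl_isomorphic r s \<tau> \<sigma> \<or> Cl_isomorphic r s \<tau> \<sigma>'))"
    if chi: "chiral p q" and \<alpha>': "Cl_irreducible p q \<alpha>'" "\<not> Cl_isomorphic p q \<alpha> \<alpha>'"
    for \<alpha>' :: "cl \<Rightarrow> 'p \<Rightarrow> 'p"
  proof -
    obtain \<sigma>' where \<sigma>': "Cl_has_map r s \<sigma>' (product (Cl_map p q \<alpha>'))" "Cl_irreducible r s \<sigma>'"
      using Cl_module_exists[OF prod[OF \<alpha>'(1)]] .
    have non: "\<not> Cl_isomorphic r s \<sigma> \<sigma>'"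
      by (rule Cl_product_not_isomorphic[folded p q, OF \<alpha> \<alpha>' \<sigma> \<sigma>'])
    have "chiral r s" using chi ch by simp
    then show ?thesis
      using prod(1)[OF \<alpha>'(1)] \<sigma>' non Cl_chiral_cases[OF _ \<sigma>(2) \<sigma>'(2) non] by blast
  qed
  show ?thesis
    using prod(1)[OF \<alpha>] \<sigma> single double Cl_chiral_other[OF _ \<alpha>] by blast
qed

end

lemma irreducible_map_one_dimensional:
  fixes c :: "'v \<Rightarrow> 'm \<Rightarrow> 'm::real_vector"
  assumes "dim (UNIV :: 'm set) = 1"
  shows "irreducible_map V c"
proof -
  obtain B :: "'m set" where B: "independent B" "UNIV \<subseteq> span B" "card B = 1"
    using basis_exists[of "UNIV :: 'm set"] assms by metis
  obtain b where b: "B = {b}" using B(3) by (auto simp: card_1_singleton_iff)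
  have b0: "b \<noteq> 0" using B(1) b by auto
  have "U = UNIV" if U: "subspace U" and x: "x \<in> U" "x \<noteq> 0" for U and x :: 'm
  proof -
    obtain a where a: "x = a *\<^sub>R b" using B(2) b by (auto simp: span_singleton)
    have "(1 / a) *\<^sub>R x \<in> U" by (rule subspace_scale[OF U x(1)])
    then have "b \<in> U" using a x(2) by simp
    then have "span {b} \<subseteq> U" by (intro span_minimal U) simp
    then show ?thesis using B(2) b by auto
  qed
  then show ?thesis
    unfolding irreducible_map_def invariant_subspace_def using b0 subspace_0 by blast
qed

theorem mainTheorem13:
  fixes r s i a b :: nat
    and \<rho> :: "cl \<Rightarrow> 'm \<Rightarrow> 'm::real_vector" and Mp Mm :: "'m set"
    and \<alpha> :: "cl \<Rightarrow> 'n \<Rightarrow> 'n::real_vector"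
    and \<beta> :: "cl \<Rightarrow> 'k \<Rightarrow> 'k::real_vector"
  assumes "r + s \<ge> 1"
    and "i = min r s" and "a = r - i" and "b = s - i"
    and S_ii_graded: "Cl_graded_module i i \<rho> Mp Mm"
    and S_ii_irreducible: "i \<ge> 1 \<Longrightarrow> Cl_irreducible i i \<rho>"
    and S_00: "i = 0 \<Longrightarrow> dim (UNIV :: 'm set) = 1 \<and> Mp = UNIV \<and> Mm = {0}"
    and S_a0: "a \<ge> 1 \<Longrightarrow> Cl_irreducible a 0 \<alpha>"
    and S_0b: "b \<ge> 1 \<Longrightarrow> Cl_irreducible 0 b \<beta>"
  shows
    "(a \<ge> 1 \<longrightarrow>
        Cl_condition r s (product_clifford_map r s (Cl_map i i \<rho>) Mp Mm (Cl_map a 0 \<alpha>)) \<and>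
        (\<exists>\<sigma>. Cl_has_map r s \<sigma> (product_clifford_map r s (Cl_map i i \<rho>) Mp Mm (Cl_map a 0 \<alpha>)) \<and>
           Cl_irreducible r s \<sigma> \<and>
           (a mod 4 \<noteq> 1 \<longrightarrow>
              (\<forall>\<tau> :: cl \<Rightarrow> 'w \<Rightarrow> 'w::real_vector.
                 Cl_irreducible r s \<tau> \<longrightarrow> Cl_isomorphic r s \<tau> \<sigma>)) \<and>
           (a mod 4 = 1 \<longrightarrow>
              (\<exists>\<alpha>' :: cl \<Rightarrow> 'n \<Rightarrow> 'n. Cl_irreducible a 0 \<alpha>' \<and> \<not> Cl_isomorphic a 0 \<alpha> \<alpha>') \<and>
              (\<forall>\<alpha>' :: cl \<Rightarrow> 'p \<Rightarrow> 'p::real_vector.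
                 Cl_irreducible a 0 \<alpha>' \<and> \<not> Cl_isomorphic a 0 \<alpha> \<alpha>' \<longrightarrow>
                 Cl_condition r s (product_clifford_map r s (Cl_map i i \<rho>) Mp Mm (Cl_map a 0 \<alpha>')) \<and>
                 (\<exists>\<sigma>'. Cl_has_map r s \<sigma>'
                         (product_clifford_map r s (Cl_map i i \<rho>) Mp Mm (Cl_map a 0 \<alpha>')) \<and>
                    Cl_irreducible r s \<sigma>' \<and> \<not> Cl_isomorphic r s \<sigma> \<sigma>' \<and>
                    (\<forall>\<tau> :: cl \<Rightarrow> 'w \<Rightarrow> 'w. Cl_irreducible r s \<tau> \<longrightarrow>
                       Cl_isomorphic r s \<tau> \<sigma> \<or> Cl_isomorphic r s \<tau> \<sigma>')))))) \<and>
     (b \<ge> 1 \<longrightarrow>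
        Cl_condition r s (product_clifford_map r s (Cl_map i i \<rho>) Mp Mm (Cl_map 0 b \<beta>)) \<and>
        (\<exists>\<sigma>. Cl_has_map r s \<sigma> (product_clifford_map r s (Cl_map i i \<rho>) Mp Mm (Cl_map 0 b \<beta>)) \<and>
           Cl_irreducible r s \<sigma> \<and>
           (b mod 4 \<noteq> 3 \<longrightarrow>
              (\<forall>\<tau> :: cl \<Rightarrow> 'w \<Rightarrow> 'w.
                 Cl_irreducible r s \<tau> \<longrightarrow> Cl_isomorphic r s \<tau> \<sigma>)) \<and>
           (b mod 4 = 3 \<longrightarrow>
              (\<exists>\<beta>' :: cl \<Rightarrow> 'k \<Rightarrow> 'k. Cl_irreducible 0 b \<beta>' \<and> \<not> Cl_isomorphic 0 b \<beta> \<beta>') \<and>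
              (\<forall>\<beta>' :: cl \<Rightarrow> 'q \<Rightarrow> 'q::real_vector.
                 Cl_irreducible 0 b \<beta>' \<and> \<not> Cl_isomorphic 0 b \<beta> \<beta>' \<longrightarrow>
                 Cl_condition r s (product_clifford_map r s (Cl_map i i \<rho>) Mp Mm (Cl_map 0 b \<beta>')) \<and>
                 (\<exists>\<sigma>'. Cl_has_map r s \<sigma>'
                         (product_clifford_map r s (Cl_map i i \<rho>) Mp Mm (Cl_map 0 b \<beta>')) \<and>
                    Cl_irreducible r s \<sigma>' \<and> \<not> Cl_isomorphic r s \<sigma> \<sigma>' \<and>
                    (\<forall>\<tau> :: cl \<Rightarrow> 'w \<Rightarrow> 'w. Cl_irreducible r s \<tau> \<longrightarrow>
                       Cl_isomorphic r s \<tau> \<sigma> \<or> Cl_isomorphic r s \<tau> \<sigma>')))))) \<and>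
     (a = 0 \<and> b = 0 \<longrightarrow>
        (\<forall>\<tau> :: cl \<Rightarrow> 'w \<Rightarrow> 'w. Cl_irreducible r s \<tau> \<longrightarrow> Cl_isomorphic r s \<tau> \<rho>))"
proof -
  have i: "i \<le> r" "i \<le> s" using assms(2) by auto
  have \<rho>: "clifford_module (Rn (i + i)) (gform i i) \<rho>" and gr: "Z2_grading Mp Mm"
    and odd: "\<And>v. v \<in> Rn (i + i) \<Longrightarrow> Cl_map i i \<rho> v ` Mp \<subseteq> Mm"
      "\<And>v. v \<in> Rn (i + i) \<Longrightarrow> Cl_map i i \<rho> v ` Mm \<subseteq> Mp"
    using S_ii_graded by (auto simp: graded_clifford_module_def)
  have irr: "irreducible_map (Rn (i + i)) (Cl_map i i \<rho>)"
  proof (cases "i = 0")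
    case True
    then show ?thesis using S_00 irreducible_map_one_dimensional by blast
  next
    case False
    then show ?thesis using Cl_irreducibleD(3)[OF S_ii_irreducible] by simp
  qed
  interpret graded_factor r s i "Cl_map i i \<rho>" Mp Mm
    by (unfold_locales; (fact assms(2) clifford_condition_module_map[OF subspace_Rn \<rho>] irr gr | erule odd))
  have chiral_a: "chiral a 0 \<longleftrightarrow> a mod 4 = 1" and chiral_b: "chiral 0 b \<longleftrightarrow> b mod 4 = 3"
    unfolding chiral_def by presburger+
  have zero_b: "a \<ge> 1 \<Longrightarrow> 0 = s - i" and zero_a: "b \<ge> 1 \<Longrightarrow> 0 = r - i"
    using assms(2-4) by auto
  note case_a = Cl_product_classification[OF assms(3) zero_b S_a0, unfolded chiral_a]
  note case_b = Cl_product_classification[OF zero_a assms(4) S_0b, unfolded chiral_b]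
  have case_0: "Cl_isomorphic r s \<tau> \<rho>"
    if "a = 0 \<and> b = 0" and \<tau>: "Cl_irreducible r s \<tau>" for \<tau> :: "cl \<Rightarrow> 'w \<Rightarrow> 'w"
  proof -
    have eq: "r = i" "s = i" "i \<ge> 1" using that(1) i assms(1,3,4) by auto
    have "\<not> chiral i i" by (simp add: chiral_def)
    then show ?thesis
      using Cl_nonchiral_isomorphic[OF _ _ S_ii_irreducible[OF eq(3)]] \<tau> unfolding eq(1,2) by blast
  qed
  show ?thesis
    by (rule conjI[OF impI conjI[OF impI]], rule case_a, assumption+, rule case_b, assumption+)
      (use case_0 in blast)
qed

end
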